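(* Fix $4 < p \leq 5$ and let $1/2\leq \delta_1 \leq 1/2+3/p$ and $1-2/p \leq \delta_2 \leq 1$. Then $$\mathscr{E}_p (\delta_1, \delta_2) = \int_{0}^{2/p}\frac{\sin^2\left(\frac{p}{2}\pi x\right)}{\pi^2 x^2}\,dx + \sum_{n=0}^{\infty} \int_{n+4/p}^{n+1/2+3/p} \frac{\sin^2\left(\frac{p}{2}\pi(x-n)\right)}{\pi^2x^2}\, dx + \sum_{n=0}^{\infty}\int_{n+1/2+3/p}^{n+1+2/p} \frac{\sin^2\left(\frac{p}{2}\pi(x-n-1)\right)}{\pi^2x^2} \, dx.$$ The supremum defining $\mathscr{E}_p(\delta_1,\delta_2)$ is attained at $\tau \in T(\delta_1,\delta_2)$ if and only if $\tau$ is the sequence given by $\tau_n=n-1/2+3/p$ for all $n \geq 1$ (and $\tau_0=0$).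
   Context: For $\delta_1,\delta_2>0$ let $T(\delta_1,\delta_2)$ be the set of strictly increasing real sequences $\tau=(\tau_n)_{n\ge 0}$ with $\tau_0=0$, $\tau_1\ge\delta_1$ and $\tau_{n+1}-\tau_n\ge\delta_2$ for all $n\ge1$. For $0<p<\infty$ and such a sequence $\tau$ define $$K_p(\tau;x)=\sum_{n=0}^\infty \chi_{(\tau_n,\tau_{n+1})}(x)\,\frac{\sin\left(\frac p2\pi(x-n)\right)}{\pi x},\qquad E_p(\tau)=\int_0^\infty\left(\max\left(0,K_p(\tau;x)\right)\right)^2dx,$$ where $\chi_{(a,b)}$ is the characteristic function of $(a,b)$, and $$\mathscr{E}_p(\delta_1,\delta_2)=\sup_{\tau\in T(\delta_1,\delta_2)}E_p(\tau).$$ *)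

theory Defs
  imports "HOL-Analysis.Analysis"
begin

definition T_seqs :: "real \<Rightarrow> real \<Rightarrow> (nat \<Rightarrow> real) set" where
  "T_seqs \<delta>\<^sub>1 \<delta>\<^sub>2 = {\<tau>. strict_mono \<tau> \<and> \<tau> 0 = 0 \<and> \<tau> 1 \<ge> \<delta>\<^sub>1 \<and>
     (\<forall>n\<ge>1. \<tau> (n + 1) - \<tau> n \<ge> \<delta>\<^sub>2)}"

text \<open>For strictly increasing \<open>\<tau>\<close> the intervals below are disjoint, so at each point at most
  one summand is nonzero and the series is a finite sum.\<close>

definition K_fun :: "real \<Rightarrow> (nat \<Rightarrow> real) \<Rightarrow> real \<Rightarrow> real" where
  "K_fun p \<tau> x =
     (\<Sum>n. indicator {\<tau> n<..<\<tau> (n + 1)} x * (sin (p / 2 * pi * (x - real n)) / (pi * x)))"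

text \<open>The integral and the supremum are taken in \<open>[0, \<infinity>]\<close>, where both always exist; no integrability
  or boundedness condition is hidden in them.\<close>

definition E_fun :: "real \<Rightarrow> (nat \<Rightarrow> real) \<Rightarrow> ennreal" where
  "E_fun p \<tau> = (\<integral>\<^sup>+x\<in>{0..}. ennreal ((max 0 (K_fun p \<tau> x))\<^sup>2) \<partial>lborel)"

definition E_sup :: "real \<Rightarrow> real \<Rightarrow> real \<Rightarrow> ennreal" where
  "E_sup p \<delta>\<^sub>1 \<delta>\<^sub>2 = (SUP \<tau>\<in>T_seqs \<delta>\<^sub>1 \<delta>\<^sub>2. E_fun p \<tau>)"

end

theory Submission
  imports Defs
begin

text \<open>Write \<open>per = 4/p\<close> for the period of the sine and \<open>eta = 1 - per\<close>. Replacing \<open>n\<close> by \<open>n + 1\<close> in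
\<open>sin (p/2 * pi * (x - n))\<close> moves the argument by a full period less \<open>eta\<close>, so a sequence \<open>\<tau>\<close> describes
a moving phase \<open>x - n * eta\<close> that every \<open>\<tau> n\<close> sets back by \<open>eta\<close>. The functional integrates
\<open>hump (phase) / (pi * x)\<^sup>2\<close>, where \<open>hump\<close> is the squared positive part of the sine. Setting the phase
back while it is on a positive half wave prolongs the time spent there.

The weight \<open>1/x\<^sup>2\<close> is a superposition of indicator functions of intervals \<open>[0, t]\<close> with positive
weights \<open>2/t\<^sup>3\<close> (\<open>E_fun_layers\<close>), so it suffices to compare, for each \<open>t\<close>, the unweighted integrals
over \<open>[0, t]\<close>. These telescope: if \<open>n\<close> jumps occur before \<open>t\<close>, the integral is the area under \<open>hump\<close>
up to the final phase \<open>t - n * eta\<close> plus one term \<open>gain (phase at the jump)\<close> for each jump, where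
\<open>gain a\<close> is the area under \<open>hump\<close> over \<open>[a - eta, a]\<close> (\<open>integrand_integral\<close>). The gain is largest,
\<open>max_gain\<close>, exactly when the window \<open>[a - eta, a]\<close> is centred at a maximum of the sine, and the sequence
\<open>n - 1/2 + 3/p\<close> makes every jump at such a phase.

Two facts make this sequence optimal. If it has jumped at least as often as \<open>\<tau>\<close>, each extra jump costs
one window of area, which is at most \<open>max_gain\<close>, and brings exactly \<open>max_gain\<close>
(\<open>cumulative_in_cell_diff_fewer\<close>). If it has jumped less often, the spacing condition on \<open>\<tau>\<close> is used:
phases of consecutive jumps are at least \<open>per/2\<close> apart, and two jumps inside one period share a single
\<open>max_gain\<close>, because two humps shifted by half a period add up to a plain squared sine (\<open>gain_pair\<close>).
Hence what the additional jumps of \<open>\<tau>\<close> earn does not exceed the area that their setbacks cost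
(\<open>spaced_sum_le\<close>). At the first index where \<open>\<tau>\<close> departs from the
optimal sequence the comparison is strict on an interval, which gives uniqueness.

The comparison for each separate \<open>t\<close> breaks down in one situation: a first jump in \<open>[1/2, per]\<close> may reuse
the end of the initial half wave, which the optimal sequence leaves alone. Such a jump gains at most
\<open>early_gain\<close>, but it delays the next half wave by \<open>eta\<close>, where the weight has become smaller. Convexity
of the weight bounds that loss from below (\<open>bump_weighted_ge\<close>), and an estimate of \<open>sin\<close> shows that the
loss exceeds the gain for every \<open>p\<close> in the range (\<open>early_gain_small\<close>).\<close>

section \<open>Integrals on the line and a bound for the sine\<close>

lemma same_derivative_same_increment:
  fixes f g :: "real \<Rightarrow> real"
  assumes "a \<le> b"
    and "\<And>x. a \<le> x \<Longrightarrow> x \<le> b \<Longrightarrow> (f has_real_derivative d x) (at x)"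
    and "\<And>x. a \<le> x \<Longrightarrow> x \<le> b \<Longrightarrow> (g has_real_derivative d x) (at x)"
  shows "f b - f a = g b - g a"
proof (cases "a < b")
  case True
  have D: "((\<lambda>x. f x - g x) has_real_derivative 0) (at x)" if "a \<le> x" "x \<le> b" for x
    using DERIV_diff[OF assms(2,3)] that by simp
  have "continuous_on {a..b} (\<lambda>x. f x - g x)"
    by (intro continuous_at_imp_continuous_on ballI DERIV_isCont[OF D]) auto
  then have "(\<lambda>x. f x - g x) b = (\<lambda>x. f x - g x) a"
    using D by (intro DERIV_isconst_end[OF True]) auto
  then show ?thesis by simp
qed (use assms(1) in simp)

lemma nn_integral_reflect:
  fixes f :: "real \<Rightarrow> ennreal"
  assumes [measurable]: "f \<in> borel_measurable borel"
  shows "(\<integral>\<^sup>+x. f x \<partial>lborel) = (\<integral>\<^sup>+x. f (c - x) \<partial>lborel)"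
  using nn_integral_real_affine[of f "-1" c] assms by simp

lemma nn_integral_Icc_eq_LBINT:
  fixes g :: "real \<Rightarrow> real"
  assumes [measurable]: "g \<in> borel_measurable borel"
    and "\<And>x. 0 \<le> g x" "a \<le> b" "(\<integral>\<^sup>+x. ennreal (g x) * indicator {a..b} x \<partial>lborel) < \<infinity>"
  shows "(\<integral>\<^sup>+x. ennreal (g x) * indicator {a..b} x \<partial>lborel) = ennreal (LBINT x=a..b. g x)"
proof -
  have "(LBINT x=a..b. g x) = (LBINT x. indicator {a..b} x * g x)"
    using interval_integral_Icc[OF assms(3), of g] by (simp add: set_lebesgue_integral_def)
  also have "\<dots> = enn2real (\<integral>\<^sup>+x. ennreal (indicator {a..b} x * g x) \<partial>lborel)"
    using assms(2) by (intro integral_eq_nn_integral) auto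
  also have "(\<integral>\<^sup>+x. ennreal (indicator {a..b} x * g x) \<partial>lborel) = (\<integral>\<^sup>+x. ennreal (g x) * indicator {a..b} x \<partial>lborel)"
    by (intro nn_integral_cong) (auto simp: indicator_def)
  finally show ?thesis using assms(4) by simp
qed

lemma LBINT_nonneg:
  fixes g :: "real \<Rightarrow> real" and a b :: real
  assumes "a \<le> b" "\<And>x. 0 \<le> g x" shows "0 \<le> (LBINT x=a..b. g x)"
  using interval_integral_Icc[OF assms(1), of g] assms(2)
  by (simp add: set_lebesgue_integral_def)

lemma AE_lborel_interval_witness:
  fixes a b :: real
  assumes "AE x in lborel. P x" "a < b"
  obtains x where "a < x" "x < b" "P x"
proof -
  have "\<exists>x. a < x \<and> x < b \<and> P x"
  proof (rule ccontr)
    assume none: "\<nexists>x. a < x \<and> x < b \<and> P x"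
    from assms(1) have "AE x in lborel. x \<notin> {a<..<b}" by eventually_elim (use none in auto)
    then have "emeasure lborel {a<..<b} = 0" by (subst (asm) AE_iff_measurable[of "{a<..<b}"]) auto
    then show False using assms(2) by simp
  qed
  then show thesis using that by blast
qed

lemma sin_deficit_le:
  fixes y :: real
  assumes "0 < y" "y \<le> 2"
  shows "1 - sin y / y \<le> y\<^sup>2 / 6 - y ^ 4 / 120 + y ^ 6 / 5040"
proof -
  have "\<bar>sin y - (\<Sum>m<7. sin_coeff m * y ^ m)\<bar> \<le> inverse (fact 7) * \<bar>y\<bar> ^ 7"
    by (rule Maclaurin_sin_bound)
  moreover have "(\<Sum>m<7. sin_coeff m * y ^ m) = y - y ^ 3 / 6 + y ^ 5 / 120"
  proof -
    have "{..<7 :: nat} = {0, 1, 2, 3, 4, 5, 6}" by auto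
    then show ?thesis by (simp add: sin_coeff_def fact_numeral)
  qed
  moreover have "fact 7 = (5040 :: real)" by (simp add: eval_nat_numeral)
  ultimately have "\<bar>sin y - (y - y ^ 3 / 6 + y ^ 5 / 120)\<bar> \<le> y ^ 7 / 5040"
    using assms by simp
  then have "y - y ^ 3 / 6 + y ^ 5 / 120 - y ^ 7 / 5040 \<le> sin y"
    unfolding abs_le_iff by linarith
  then have "(y - y ^ 3 / 6 + y ^ 5 / 120 - y ^ 7 / 5040) / y \<le> sin y / y"
    using assms by (intro divide_right_mono) auto
  moreover have "(y - y ^ 3 / 6 + y ^ 5 / 120 - y ^ 7 / 5040) / y = 1 - y\<^sup>2 / 6 + y ^ 4 / 120 - y ^ 6 / 5040"
    using assms by (simp add: field_simps eval_nat_numeral)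
  ultimately show ?thesis by linarith
qed

text \<open>The deficit \<open>1 - sin y / y\<close> measures the gain of a premature first jump relative to \<open>eta\<close>, with
\<open>y\<close> the angle \<open>omega * eta\<close>, which never exceeds \<open>pi / 2\<close>. The first bound is for small \<open>eta\<close>, where the loss
caused by such a jump is also small; the second covers the rest of the range.\<close>

lemma sin_deficit_bounds:
  fixes y :: real
  assumes "0 < y"
  shows "y \<le> 6/5 \<Longrightarrow> 1 - sin y / y \<le> 1/4" "y \<le> pi / 2 \<Longrightarrow> 1 - sin y / y \<le> 37/100"
proof -
  define z where "z = y\<^sup>2"
  have z0: "0 \<le> z" by (simp add: z_def)
  (* The bracket is 1/120 - (5/2)/5040: the sixth-order term is absorbed into the
     fourth-order one by z <= 5/2. *)
  have B: "1 - sin y / y \<le> z / 6 - z\<^sup>2 * (21/2520 - 5/10080)" if "z \<le> 5/2" "y \<le> 2"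
  proof -
    have "y ^ 4 = z\<^sup>2" "y ^ 6 = z\<^sup>2 * z" by (simp_all add: z_def eval_nat_numeral)
    moreover have "z\<^sup>2 * z \<le> z\<^sup>2 * (5/2)" using that by (intro mult_left_mono) auto
    ultimately show ?thesis using sin_deficit_le[OF assms that(2)] by (simp add: z_def[symmetric])
  qed
  show "1 - sin y / y \<le> 1/4" if "y \<le> 6/5"
  proof -
    have "z \<le> (6/5)\<^sup>2" unfolding z_def using that assms by (intro power_mono) auto
    then have "z \<le> 36/25" by (simp add: power2_eq_square)
    moreover have "0 \<le> z\<^sup>2 * (21/2520 - 5/10080)" by simp
    ultimately show ?thesis using B that by linarith
  qed
  show "1 - sin y / y \<le> 37/100" if "y \<le> pi / 2"
  proof -
    have y: "y \<le> 1.58" using that pi_approx by simp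
    have "z \<le> 1.58\<^sup>2" unfolding z_def using y assms by (intro power_mono) auto
    then have z: "z \<le> 5/2" by (simp add: power2_eq_square)
    define q :: real where "q = 21/2520 - 5/10080"
    have "0 \<le> (5/2 - z) * (1/6 - q * (5/2 + z))"
      using z by (intro mult_nonneg_nonneg) (auto simp: q_def)
    also have "\<dots> = (5/2) / 6 - q * (5/2)\<^sup>2 - (z / 6 - z\<^sup>2 * q)"
      by (simp add: field_simps power2_eq_square)
    finally show ?thesis using B[OF z] y by (simp add: q_def power2_eq_square)
  qed
qed

section \<open>The phase, the humps and the gain of a jump\<close>

locale sine_blocks =
  fixes p :: real
  assumes p_gt: "4 < p" and p_le: "p \<le> 5"
begin

definition per :: real where "per = 4 / p"

text \<open>Because \<open>1 = per + eta\<close>, raising the index \<open>n\<close> by one acts on the \<open>per\<close>-periodic sine exactly like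
setting its argument back by \<open>eta\<close>. All later formulas use the argument \<open>x - n * eta\<close>, called the phase,
instead of \<open>x - n\<close>.\<close>

definition eta :: real where "eta = 1 - per"
definition omega :: real where "omega = p / 2 * pi"
definition hump :: "real \<Rightarrow> real" where "hump u = (max 0 (sin (omega * u)))\<^sup>2"
definition area :: "real \<Rightarrow> real" where "area u = (LBINT x=0..u. hump x)"

text \<open>A jump at phase \<open>a\<close> makes the phase run through \<open>[a - eta, a]\<close> a second time; \<open>gain a\<close> is the area
collected in that repetition.\<close>

definition gain :: "real \<Rightarrow> real" where "gain a = area a - area (a - eta)"

text \<open>The window \<open>[peak - eta, peak]\<close> is centred at the maximum \<open>per / 4\<close> of the sine.\<close>

definition peak :: real where "peak = per / 4 + eta / 2"
definition max_gain :: real where "max_gain = gain peak"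

lemma per_bounds: "4/5 \<le> per" "per < 1"
  using p_gt p_le by (auto simp: per_def field_simps)

lemma eta_bounds: "0 < eta" "eta \<le> 1/5" "per + eta = 1"
  using per_bounds by (auto simp: eta_def)

lemma omega_pos: "0 < omega" using p_gt by (simp add: omega_def)

lemma omega_per: "omega * per = 2 * pi"
  using p_gt by (simp add: omega_def per_def)

lemma omega_half: "omega * (per / 2) = pi" using omega_per by simp

lemma continuous_hump [continuous_intros]: "continuous_on A hump"
  unfolding hump_def by (intro continuous_intros)

lemma hump_nonneg: "0 \<le> hump u" by (simp add: hump_def)

lemma hump_le_1: "hump u \<le> 1"
proof -
  have "max 0 (sin (omega * u)) \<le> 1" by simp
  then have "(max 0 (sin (omega * u)))\<^sup>2 \<le> 1\<^sup>2" by (intro power_mono) auto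
  then show ?thesis by (simp add: hump_def)
qed

lemma sin_omega_half: "sin (omega * (u + per / 2)) = - sin (omega * u)"
  using omega_half by (simp add: distrib_left)

text \<open>The positive and the negative half waves of the sine are translates of each other by half a period.\<close>

lemma hump_half: "hump u + hump (u + per / 2) = (sin (omega * u))\<^sup>2"
  unfolding hump_def sin_omega_half by (cases "0 \<le> sin (omega * u)") (auto simp: max_def)

lemma hump_periodic: "hump (u + per) = hump u"
  using sin_omega_half[of u] sin_omega_half[of "u + per/2"] by (simp add: hump_def add.assoc)

lemma sin_omega_nonneg: "0 \<le> u \<Longrightarrow> u \<le> per / 2 \<Longrightarrow> 0 \<le> sin (omega * u)"
  using omega_pos omega_half mult_left_mono[of u "per/2" omega] by (intro sin_ge_zero) auto

lemma hump_on_hump: "0 \<le> u \<Longrightarrow> u \<le> per / 2 \<Longrightarrow> hump u = (sin (omega * u))\<^sup>2"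
  using sin_omega_nonneg by (simp add: hump_def)

lemma hump_off_hump: "per / 2 \<le> u \<Longrightarrow> u \<le> per \<Longrightarrow> hump u = 0"
  using hump_half[of "u - per/2"] hump_on_hump[of "u - per/2"] by simp

lemma hump_before_hump: "- per / 2 \<le> u \<Longrightarrow> u \<le> 0 \<Longrightarrow> hump u = 0"
  using hump_off_hump[of "u + per"] hump_periodic[of u] by simp

lemma area_deriv: "(area has_real_derivative hump u) (at u)"
proof -
  define c where "c = \<bar>u\<bar> + 1"
  have "((\<lambda>v. LBINT y=0..v. hump y) has_vector_derivative hump u) (at u within {-c..c})"
    unfolding zero_ereal_def by (rule interval_integral_FTC2) (auto simp: c_def intro: continuous_hump)
  moreover have "at u within {-c..c} = at u"
    by (rule at_within_interior) (auto simp: c_def)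
  ultimately show ?thesis
    by (simp add: area_def[abs_def] has_real_derivative_iff_has_vector_derivative)
qed

lemma area_deriv_chain [derivative_intros]:
  "(f has_real_derivative d) (at x) \<Longrightarrow> ((\<lambda>x. area (f x)) has_real_derivative hump (f x) * d) (at x)"
  by (rule DERIV_chain2[OF area_deriv])

lemma continuous_area [continuous_intros]: "continuous_on A f \<Longrightarrow> continuous_on A (\<lambda>x. area (f x))"
proof -
  have "continuous_on UNIV area"
    by (intro continuous_at_imp_continuous_on ballI DERIV_isCont[OF area_deriv])
  then show "continuous_on A f \<Longrightarrow> continuous_on A (\<lambda>x. area (f x))"
    using continuous_on_compose2 by blast
qed

lemma area_0: "area 0 = 0" by (simp add: area_def zero_ereal_def)

lemma area_mono: "u \<le> v \<Longrightarrow> area u \<le> area v"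
  by (rule DERIV_nonneg_imp_nondecreasing[of u v area]) (use area_deriv hump_nonneg in blast)+

definition sin2_area :: "real \<Rightarrow> real" where "sin2_area u = u / 2 - sin (2 * (omega * u)) / (4 * omega)"

lemma sin2_area_deriv: "(sin2_area has_real_derivative (sin (omega * u))\<^sup>2) (at u)"
proof -
  have "(sin2_area has_real_derivative 1 / 2 - cos (2 * (omega * u)) * (2 * omega) / (4 * omega)) (at u)"
    unfolding sin2_area_def[abs_def] using omega_pos by (auto intro!: derivative_eq_intros)
  then show ?thesis using omega_pos by (simp add: cos_double_sin diff_divide_distrib)
qed

text \<open>On the first half wave \<open>hump\<close> is \<open>sin\<^sup>2\<close>, so its area is elementary. The next two lemmas record that
the area is constant on the half waves on either side.\<close>

lemma area_on_hump: assumes "0 \<le> u" "u \<le> per / 2" shows "area u = sin2_area u"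
proof -
  have "area u - area 0 = sin2_area u - sin2_area 0"
  proof (rule same_derivative_same_increment[of 0 u area "\<lambda>x. (sin (omega * x))\<^sup>2" sin2_area])
    show "(area has_real_derivative (sin (omega * x))\<^sup>2) (at x)" if "0 \<le> x" "x \<le> u" for x
      using area_deriv[of x] hump_on_hump[of x] that assms by simp
  qed (use assms sin2_area_deriv in auto)
  then show ?thesis by (simp add: area_0 sin2_area_def)
qed

lemma area_off_hump: assumes "per / 2 \<le> u" "u \<le> v" "v \<le> per" shows "area u = area v"
proof -
  have "area v - area u = 0 - 0"
  proof (rule same_derivative_same_increment[of u v area "\<lambda>x. 0" "\<lambda>x. 0"])
    show "(area has_real_derivative 0) (at x)" if "u \<le> x" "x \<le> v" for x
      using area_deriv[of x] hump_off_hump[of x] that assms by simp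
  qed (use assms in auto)
  then show ?thesis by simp
qed

lemma area_before_hump: assumes "- per / 2 \<le> u" "u \<le> 0" shows "area u = 0"
proof -
  have "area 0 - area u = 0 - 0"
  proof (rule same_derivative_same_increment[of u 0 area "\<lambda>x. 0" "\<lambda>x. 0"])
    show "(area has_real_derivative 0) (at x)" if "u \<le> x" "x \<le> 0" for x
      using area_deriv[of x] hump_before_hump[of x] that assms by simp
  qed (use assms in auto)
  then show ?thesis by (simp add: area_0)
qed

lemma area_periodic_increment: "area (u + per) - area (v + per) = area u - area v"
proof -
  have "(\<lambda>x. area (x + per) - area x) u = (\<lambda>x. area (x + per) - area x) v"
    by (rule DERIV_isconst_all)
      (auto intro!: derivative_eq_intros simp: hump_periodic)
  then show ?thesis by simp
qed

lemma area_half_increment: "area u + area (u + per / 2) - (area v + area (v + per / 2)) = sin2_area u - sin2_area v"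
proof -
  have "(\<lambda>x. area x + area (x + per / 2) - sin2_area x) u = (\<lambda>x. area x + area (x + per / 2) - sin2_area x) v"
    by (rule DERIV_isconst_all)
      (auto intro!: derivative_eq_intros sin2_area_deriv simp: hump_half)
  then show ?thesis by simp
qed

lemma gain_periodic: "gain (a + per) = gain a"
  using area_periodic_increment[of a "a - eta"] by (simp add: gain_def algebra_simps)

lemma gain_periodic_nat: "gain (a + real n * per) = gain a"
proof (induction n)
  case (Suc n)
  then show ?case using gain_periodic[of "a + real n * per"] by (simp add: algebra_simps)
qed simp

lemma gain_nonneg: "0 \<le> gain a"
  using area_mono[of "a - eta" a] eta_bounds by (simp add: gain_def)

text \<open>The humps seen by two jumps half a period apart are complementary halves of \<open>sin\<^sup>2\<close>, so together the two
jumps collect the integral of \<open>sin\<^sup>2\<close> over one window of length \<open>eta\<close>.\<close>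

lemma gain_pair: "gain a + gain (a + per / 2) = eta / 2 - cos (omega * (2 * a - eta)) * sin (omega * eta) / (2 * omega)"
proof -
  have "gain a + gain (a + per / 2) = sin2_area a - sin2_area (a - eta)"
    using area_half_increment[of a "a - eta"] by (simp add: gain_def algebra_simps)
  also have "\<dots> = eta / 2 - (sin (2 * (omega * a)) - sin (2 * (omega * (a - eta)))) / (4 * omega)"
    by (simp add: sin2_area_def diff_divide_distrib)
  also have "sin (2 * (omega * a)) - sin (2 * (omega * (a - eta))) = 2 * (sin (omega * eta) * cos (omega * (2 * a - eta)))"
    by (subst sin_diff_sin) (simp add: algebra_simps diff_divide_distrib)
  finally show ?thesis by (simp add: mult.commute)
qed

lemma gain_at_rest: "per / 2 + eta \<le> a \<Longrightarrow> a \<le> per \<Longrightarrow> gain a = 0"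
  using area_off_hump[of "a - eta" a] eta_bounds by (simp add: gain_def)

lemma gain_0: "gain 0 = 0"
  using gain_at_rest[of per] gain_periodic[of 0] eta_bounds per_bounds by simp

lemma omega_eta: "0 < omega * eta" "omega * eta \<le> pi / 2"
proof -
  show "0 < omega * eta" using omega_pos eta_bounds by simp
  have "omega * eta \<le> omega * (per / 4)" using omega_pos eta_bounds per_bounds by (intro mult_left_mono) auto
  then show "omega * eta \<le> pi / 2" using omega_per by simp
qed

lemma sin_omega_eta: "0 < sin (omega * eta)"
  using omega_eta pi_gt_zero by (intro sin_gt_zero) linarith+

lemma omega_peak: "omega * (2 * peak - eta) = pi" using omega_half by (simp add: peak_def)

text \<open>Half a period after \<open>peak\<close> the whole window lies where \<open>hump\<close> vanishes, so \<open>gain_pair\<close> gives \<open>gain peak\<close>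
alone; the cosine there is \<open>-1\<close>.\<close>

lemma max_gain_eq: "max_gain = eta / 2 + sin (omega * eta) / (2 * omega)"
proof -
  have "gain (peak + per / 2) = 0"
    by (rule gain_at_rest) (use eta_bounds per_bounds in \<open>auto simp: peak_def field_simps\<close>)
  then show ?thesis using gain_pair[of peak] omega_peak by (simp add: max_gain_def)
qed

lemma max_gain_pos: "0 < max_gain"
  using max_gain_eq sin_omega_eta omega_pos eta_bounds by (simp add: add_pos_pos)

text \<open>This bounds two jumps in the same period by the gain of one, and, since gains are nonnegative, it also
makes \<open>max_gain\<close> the maximum of \<open>gain\<close>.\<close>

lemma gain_pair_le: "gain a + gain (a + per / 2) \<le> max_gain"
proof -
  have "- (cos (omega * (2 * a - eta)) * sin (omega * eta)) \<le> sin (omega * eta)"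
    using sin_omega_eta cos_ge_minus_one[of "omega * (2 * a - eta)"]
      mult_right_mono[of "-1" "cos (omega * (2 * a - eta))" "sin (omega * eta)"] by simp
  from divide_right_mono[OF this, of "2 * omega"] show ?thesis using omega_pos by (simp add: gain_pair max_gain_eq)
qed

lemma gain_le: "gain a \<le> max_gain"
  using gain_pair_le[of a] gain_nonneg[of "a + per/2"] by simp

text \<open>In \<open>gain_pair\<close> the bound is attained only where the cosine is \<open>-1\<close>, that is at \<open>peak\<close> modulo half a
period. The one such point strictly inside the period is \<open>peak + per / 2\<close>, where the gain is zero.\<close>

lemma gain_less:
  assumes "peak < a" "a < peak + per" shows "gain a < max_gain"
proof (cases "a = peak + per / 2")
  case True
  then have "gain a = 0"
    by (intro gain_at_rest) (use eta_bounds per_bounds in \<open>auto simp: peak_def field_simps\<close>)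
  then show ?thesis using max_gain_pos by simp
next
  case False
  define y where "y = omega * (2 * a - eta) - pi"
  have y: "y = omega * (2 * (a - peak))" using omega_peak by (simp add: y_def algebra_simps)
  have "0 < y" using omega_pos assms by (simp add: y)
  moreover have "y < 4 * pi"
  proof -
    have "y < omega * (2 * per)" unfolding y using omega_pos assms by (intro mult_strict_left_mono) auto
    then show ?thesis using omega_per by simp
  qed
  moreover have "y \<noteq> 2 * pi"
  proof
    assume "y = 2 * pi"
    then have "omega * (2 * (a - peak)) = omega * per" using omega_per by (simp add: y)
    then show False using False omega_pos by simp
  qed
  ultimately have "cos y \<noteq> 1"
  proof -
    assume y: "0 < y" "y < 4 * pi" "y \<noteq> 2 * pi"
    have False if "y = real_of_int n * 2 * pi" for n
    proof -
      have "0 < real_of_int n" "real_of_int n < 2"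
        using y that by (simp_all add: zero_less_mult_iff)
      then have "n = 1" by linarith
      then show False using y that by simp
    qed
    then show ?thesis unfolding cos_one_2pi_int by blast
  qed
  then have "cos y < 1" using cos_le_one[of y] by linarith
  moreover have "cos (omega * (2 * a - eta)) = - cos y" by (simp add: y_def)
  ultimately have "- cos (omega * (2 * a - eta)) < 1" by simp
  then have "- (cos (omega * (2 * a - eta)) * sin (omega * eta)) < sin (omega * eta)"
    using sin_omega_eta mult_strict_right_mono[of "- cos (omega * (2 * a - eta))" 1 "sin (omega * eta)"] by simp
  from divide_strict_right_mono[OF this, of "2 * omega"] have "gain a + gain (a + per / 2) < max_gain"
    using omega_pos by (simp add: gain_pair max_gain_eq)
  then show ?thesis using gain_nonneg[of "a + per/2"] by simp
qed

lemma gain_deriv: "(gain has_real_derivative (hump a - hump (a - eta))) (at a)"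
  unfolding gain_def[abs_def] by (auto intro!: derivative_eq_intros)

lemma continuous_gain [continuous_intros]: "continuous_on A f \<Longrightarrow> continuous_on A (\<lambda>x. gain (f x))"
  unfolding gain_def by (intro continuous_intros)

text \<open>Up to \<open>peak\<close> the front end of the window is at least as high on the hump as its rear end.\<close>

lemma gain_mono: assumes "0 \<le> a" "a \<le> b" "b \<le> peak" shows "gain a \<le> gain b"
proof (rule DERIV_nonneg_imp_nondecreasing[OF assms(2)])
  fix x assume x: "a \<le> x" "x \<le> b"
  have bd: "0 \<le> x" "x \<le> peak" using x assms by auto
  have "hump (x - eta) \<le> hump x"
  proof (cases "x \<le> eta")
    case True
    then have "hump (x - eta) = 0" using bd eta_bounds per_bounds by (intro hump_before_hump) auto
    then show ?thesis using hump_nonneg by simp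
  next
    case False
    have up: "x \<le> per / 2" using bd eta_bounds per_bounds by (simp add: peak_def)
    have 1: "0 \<le> sin (omega * (x - eta))" using False up eta_bounds by (intro sin_omega_nonneg) auto
    have "sin (omega * x) - sin (omega * (x - eta)) = 2 * (sin (omega * eta / 2) * cos (omega * (2 * x - eta) / 2))"
      by (subst sin_diff_sin) (simp add: algebra_simps)
    moreover have "0 \<le> sin (omega * eta / 2)" using omega_eta pi_gt_zero by (intro sin_ge_zero) linarith+
    moreover have "0 \<le> cos (omega * (2 * x - eta) / 2)"
    proof (rule cos_ge_zero)
      have "omega * (2 * x - eta) \<le> omega * (2 * peak - eta)" using omega_pos bd by (intro mult_left_mono) auto
      then show "omega * (2 * x - eta) / 2 \<le> pi / 2" using omega_peak by simp
      have "0 \<le> omega * (2 * x - eta)" using omega_pos False eta_bounds by simp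
      then show "- (pi / 2) \<le> omega * (2 * x - eta) / 2" using pi_gt_zero by linarith
    qed
    ultimately have 2: "sin (omega * (x - eta)) \<le> sin (omega * x)"
      by (metis diff_ge_0_iff_ge mult_nonneg_nonneg zero_le_numeral)
    then show ?thesis unfolding hump_def using 1 by (intro power_mono) auto
  qed
  then show "\<exists>y. (gain has_real_derivative y) (at x) \<and> 0 \<le> y" using gain_deriv by fastforce
qed

lemma gain_antimono: assumes "per / 2 \<le> a" "a \<le> b" "b \<le> per" shows "gain b \<le> gain a"
proof (rule DERIV_nonpos_imp_nonincreasing[OF assms(2)])
  fix x assume x: "a \<le> x" "x \<le> b"
  then have "hump x = 0" using assms by (intro hump_off_hump) auto
  then show "\<exists>y. (gain has_real_derivative y) (at x) \<and> y \<le> 0"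
    using gain_deriv[of x] hump_nonneg[of "x - eta"] by auto
qed

lemma gain_shift_mono:
  assumes "real m * per \<le> a" "a \<le> b" "b \<le> real m * per + peak" shows "gain a \<le> gain b"
  using gain_mono[of "a - real m * per" "b - real m * per"] assms
    gain_periodic_nat[of "a - real m * per" m] gain_periodic_nat[of "b - real m * per" m] by simp

lemma gain_multiple: "gain (real m * per) = 0"
  using gain_periodic_nat[of 0 m] gain_0 by simp

lemma peak_bounds: "eta \<le> peak" "peak \<le> per / 2"
  using eta_bounds per_bounds by (auto simp: peak_def)

text \<open>The jumps of an arbitrary sequence, at phases \<open>th j\<close> at least half a period apart, cannot
collect more than one \<open>max_gain\<close> in each full period, and the last, incomplete period contributes at most
the gain at the current bound \<open>y\<close>. The starting condition excludes the initial half wave. The induction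
needs all \<open>m\<close> and \<open>y\<close>, because a jump that shares its period with the preceding one is paired with it by
\<open>gain_pair_le\<close>, and the earlier jumps are then bounded with one period fewer.\<close>

lemma spaced_sum_le:
  fixes th :: "nat \<Rightarrow> real"
  assumes gap: "\<And>j. th j + per / 2 \<le> th (Suc j)" and start: "per / 2 + eta \<le> th 0"
  shows "(\<forall>j<k. th j \<le> y) \<Longrightarrow> y \<le> real (Suc m) * per + peak \<Longrightarrow>
    (\<Sum>j<k. gain (th j)) \<le> real m * max_gain + gain y"
proof (induction k arbitrary: m y)
  case 0
  then show ?case using max_gain_pos gain_nonneg[of y] by simp
next
  case (Suc k)
  have "th j \<le> th (Suc j)" for j using gap[of j] per_bounds by linarith
  then have mono: "th i \<le> th j" if "i \<le> j" for i j
    using lift_Suc_mono_le[of th] that by blast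
  have below: "\<forall>j<k. th j \<le> v" if "th k - per / 2 \<le> v" for v
  proof (intro allI impI)
    fix j assume "j < k"
    then have "th (Suc j) \<le> th k" by (intro mono) simp
    then show "th j \<le> v" using gap[of j] that by simp
  qed
  have xy: "th k \<le> y" using Suc.prems by simp
  have per0: "0 < per" using per_bounds by simp
  have prev: "(\<Sum>j<k. gain (th j)) \<le> real m * max_gain" if "th k - per / 2 \<le> real (Suc m) * per"
    using Suc.IH[OF below[OF that], of m] peak_bounds eta_bounds gain_multiple[of "Suc m"] by simp
  show ?case
  proof (cases "real (Suc m) * per \<le> th k")
    case True
    have "gain (th k) \<le> gain y" by (rule gain_shift_mono[OF True xy]) (use Suc.prems in simp)
    moreover have "th k - per / 2 \<le> real (Suc m) * per" using xy Suc.prems peak_bounds by linarith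
    ultimately show ?thesis using prev by simp
  next
    case False
    then have S: "(\<Sum>j<k. gain (th j)) \<le> real m * max_gain" using prev per0 by linarith
    show ?thesis
    proof (cases m)
      case 0
      have "gain (th k) = 0"
        by (rule gain_at_rest) (use start mono[of 0 k] False 0 in auto)
      then show ?thesis using S gain_nonneg[of y] by simp
    next
      case (Suc m')
      (* The new jump lies before the start of period m + 1; a is its position relative to the start
         of period m. *)
      define a where "a = th k - real m * per"
      have a: "gain (th k) = gain a" using gain_periodic_nat[of a m] by (simp add: a_def)
      have "a < per" using False by (simp add: a_def algebra_simps)
      consider "per / 2 + eta \<le> a" | "per / 2 \<le> a" "a < per / 2 + eta" | "a < per / 2" by linarith
      then show ?thesis
      proof cases
        case 1
        then have "gain (th k) = 0" unfolding a using \<open>a < per\<close> by (intro gain_at_rest) auto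
        then show ?thesis using S gain_nonneg[of y] by simp
      next
        case 2
        (* All earlier jumps are at least half a period behind, so the partner of the new jump in
           gain_pair_le is the phase exactly half a period behind it. *)
        have "(\<Sum>j<k. gain (th j)) \<le> real m' * max_gain + gain (a - per / 2 + real m * per)"
          by (rule Suc.IH[OF below]) (use 2 peak_bounds Suc in \<open>auto simp: a_def\<close>)
        then have "(\<Sum>j<k. gain (th j)) \<le> real m' * max_gain + gain (a - per / 2)"
          by (simp add: gain_periodic_nat)
        then show ?thesis using gain_pair_le[of "a - per/2"] a gain_nonneg[of y] Suc
          by (simp add: algebra_simps)
      next
        case 3
        have "(\<Sum>j<k. gain (th j)) \<le> real m' * max_gain + gain (real m * per)"
          by (rule Suc.IH[OF below]) (use 3 peak_bounds eta_bounds Suc in \<open>auto simp: a_def\<close>)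
        then show ?thesis using gain_multiple[of m] gain_le[of "th k"] gain_nonneg[of y] Suc
          by (simp add: algebra_simps)
      qed
    qed
  qed
qed

section \<open>The integrand as a function of the phase\<close>

text \<open>Among the parameters \<open>\<delta>\<^sub>1 \<ge> 1/2\<close> and \<open>\<delta>\<^sub>2 \<ge> 1 - 2/p\<close> this is the largest class of sequences, and the
comparison is carried out in it; note \<open>per / 2 = 2/p\<close>.\<close>

definition admissible :: "(nat \<Rightarrow> real) \<Rightarrow> bool" where
  "admissible \<tau> \<longleftrightarrow> \<tau> \<in> T_seqs (1/2) (1 - per / 2)"

text \<open>The phase immediately before jump number \<open>j + 1\<close>, so jumps are counted from \<open>0\<close> here.\<close>

definition jump_phase :: "(nat \<Rightarrow> real) \<Rightarrow> nat \<Rightarrow> real" where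
  "jump_phase \<tau> j = \<tau> (Suc j) - real j * eta"

text \<open>A gap of \<open>1 - per / 2\<close> between jumps, less the setback \<open>eta\<close>, is half a period in the phase.\<close>

lemma admissibleD:
  assumes "admissible \<tau>"
  shows "strict_mono \<tau>" "\<tau> 0 = 0" "1/2 \<le> jump_phase \<tau> 0" "jump_phase \<tau> j + per / 2 \<le> jump_phase \<tau> (Suc j)"
proof -
  have T: "strict_mono \<tau>" "\<tau> 0 = 0" "1/2 \<le> \<tau> 1" "1 - per / 2 \<le> \<tau> (n + 1) - \<tau> n" if "1 \<le> n" for n
    using assms that by (auto simp: admissible_def T_seqs_def)
  show "strict_mono \<tau>" "\<tau> 0 = 0" using T by auto
  show "1/2 \<le> jump_phase \<tau> 0" using T(3)[of 1] by (simp add: jump_phase_def)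
  show "jump_phase \<tau> j + per / 2 \<le> jump_phase \<tau> (Suc j)"
    using T(4)[of "Suc j"] eta_bounds by (simp add: jump_phase_def algebra_simps)
qed

lemma admissible_ge: assumes "admissible \<tau>" shows "real n / 2 \<le> \<tau> n"
proof (induction n)
  case (Suc n)
  show ?case
  proof (cases n)
    case 0
    then show ?thesis using admissibleD(3)[OF assms] by (simp add: jump_phase_def)
  next
    case (Suc k)
    have "jump_phase \<tau> k + per / 2 \<le> jump_phase \<tau> n" using admissibleD(4)[OF assms, of k] Suc by simp
    then have "\<tau> n + eta + per / 2 \<le> \<tau> (Suc n)" using Suc by (simp add: jump_phase_def algebra_simps)
    then show ?thesis using \<open>real n / 2 \<le> \<tau> n\<close> eta_bounds by (simp add: field_simps)
  qed
qed (simp add: admissibleD(2)[OF assms])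

lemma admissible_cell:
  assumes "admissible \<tau>" "0 \<le> t" obtains n where "\<tau> n \<le> t" "t < \<tau> (Suc n)"
proof -
  obtain k0 :: nat where "2 * t < real k0" using reals_Archimedean2 by blast
  then have "t < \<tau> k0" using admissible_ge[OF assms(1), of k0] by simp
  define k where "k = (LEAST k. t < \<tau> k)"
  have k: "t < \<tau> k" unfolding k_def by (rule LeastI[of _ k0]) (rule \<open>t < \<tau> k0\<close>)
  then obtain n where n: "k = Suc n" using admissibleD(2)[OF assms(1)] assms(2) by (cases k) auto
  have "\<not> t < \<tau> n" using n not_less_Least[of n "\<lambda>k. t < \<tau> k"] by (simp add: k_def)
  then show thesis using that[of n] k n by simp
qed

text \<open>What remains of the squared positive part of \<open>K_fun\<close> when the factor \<open>1 / (pi * x)\<^sup>2\<close> is removed.\<close>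

definition integrand :: "(nat \<Rightarrow> real) \<Rightarrow> real \<Rightarrow> real" where
  "integrand \<tau> x = (pi * x * max 0 (K_fun p \<tau> x))\<^sup>2"

lemma K_fun_cell:
  assumes "strict_mono \<tau>" "\<tau> n < x" "x < \<tau> (Suc n)"
  shows "K_fun p \<tau> x = sin (omega * (x - real n)) / (pi * x)"
proof -
  have only: "k = n" if "\<tau> k < x" "x < \<tau> (Suc k)" for k
  proof -
    have "\<tau> k < \<tau> (Suc n)" "\<tau> n < \<tau> (Suc k)" using that assms by auto
    then have "k < Suc n" "n < Suc k" by (simp_all add: strict_mono_less[OF assms(1)])
    then show "k = n" by simp
  qed
  have "indicator {\<tau> k<..<\<tau> (k + 1)} x * (sin (p / 2 * pi * (x - real k)) / (pi * x))
      = (if k = n then sin (omega * (x - real n)) / (pi * x) else 0)" for k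
  proof (cases "k = n")
    case False
    then have "x \<notin> {\<tau> k<..<\<tau> (k + 1)}" using only[of k] by auto
    then show ?thesis using False by simp
  qed (use assms in \<open>simp add: omega_def\<close>)
  then show ?thesis unfolding K_fun_def
    using sums_unique[OF sums_single[of n "\<lambda>_. sin (omega * (x - real n)) / (pi * x)"]] by simp
qed

lemma hump_periodic_nat: "hump (u + real n * per) = hump u"
proof (induction n)
  case (Suc n)
  then show ?case using hump_periodic[of "u + real n * per"] by (simp add: algebra_simps)
qed simp

lemma integrand_cell:
  assumes "strict_mono \<tau>" "\<tau> 0 = 0" "\<tau> n < x" "x < \<tau> (Suc n)"
  shows "integrand \<tau> x = hump (x - real n * eta)"
proof -
  have "0 \<le> \<tau> n" using strict_mono_less_eq[OF assms(1), of 0 n] assms(2) by simp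
  then have x: "0 < x" using assms by simp
  have "pi * x * max 0 (K_fun p \<tau> x) = max 0 (sin (omega * (x - real n)))"
  proof -
    have "0 < pi * x" using x by simp
    then show ?thesis
      unfolding K_fun_cell[OF assms(1,3,4)] using x by (simp add: max_mult_distrib_left)
  qed
  then have "integrand \<tau> x = hump (x - real n)" by (simp add: integrand_def hump_def)
  also have "\<dots> = hump (x - real n + real n * per)" by (simp add: hump_periodic_nat)
  also have "x - real n + real n * per = x - real n * eta" by (simp add: eta_def algebra_simps)
  finally show ?thesis .
qed

text \<open>The integral of \<open>integrand \<tau>\<close> over \<open>[0, t]\<close> when exactly \<open>n\<close> jumps precede \<open>t\<close>. Each setback of the
phase at a jump is compensated by the corresponding \<open>gain\<close>, which makes the areas telescope.\<close>

definition cumulative_in_cell :: "(nat \<Rightarrow> real) \<Rightarrow> nat \<Rightarrow> real \<Rightarrow> real" where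
  "cumulative_in_cell \<tau> n t = area (t - real n * eta) + (\<Sum>j<n. gain (jump_phase \<tau> j))"

lemma integrand_integral_in_cell:
  assumes "strict_mono \<tau>" "\<tau> 0 = 0" "\<tau> n \<le> t" "t \<le> \<tau> (Suc n)"
  shows "(integrand \<tau> has_integral (area (t - real n * eta) - area (\<tau> n - real n * eta))) {\<tau> n..t}"
proof (rule has_integral_spike_finite[of "{\<tau> n, t}"])
  show "((\<lambda>x. hump (x - real n * eta)) has_integral (area (t - real n * eta) - area (\<tau> n - real n * eta))) {\<tau> n..t}"
  proof (rule fundamental_theorem_of_calculus[OF assms(3)])
    fix x
    have "((\<lambda>x. area (x - real n * eta)) has_real_derivative hump (x - real n * eta)) (at x)"
      by (auto intro!: derivative_eq_intros)
    then show "((\<lambda>x. area (x - real n * eta)) has_vector_derivative hump (x - real n * eta)) (at x within {\<tau> n..t})"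
      by (simp add: has_real_derivative_iff_has_vector_derivative has_vector_derivative_at_within)
  qed
  show "integrand \<tau> x = hump (x - real n * eta)" if "x \<in> {\<tau> n..t} - {\<tau> n, t}" for x
    by (rule integrand_cell[OF assms(1,2)]) (use that assms(4) in simp_all)
qed simp

lemma integrand_integral:
  assumes "strict_mono \<tau>" "\<tau> 0 = 0"
  shows "\<tau> n \<le> t \<Longrightarrow> t \<le> \<tau> (Suc n) \<Longrightarrow> (integrand \<tau> has_integral cumulative_in_cell \<tau> n t) {0..t}"
proof (induction n arbitrary: t)
  case 0
  then show ?case using integrand_integral_in_cell[OF assms, of 0 t] assms by (simp add: cumulative_in_cell_def area_0)
next
  case (Suc n)
  have "\<tau> n \<le> \<tau> (Suc n)" "0 \<le> \<tau> (Suc n)"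
    using strict_mono_less_eq[OF assms(1), of n "Suc n"]
      strict_mono_less_eq[OF assms(1), of 0 "Suc n"] assms(2) by simp_all
  then have "(integrand \<tau> has_integral cumulative_in_cell \<tau> n (\<tau> (Suc n)) + (area (t - real (Suc n) * eta) - area (\<tau> (Suc n) - real (Suc n) * eta))) {0..t}"
    using Suc.prems by (intro has_integral_combine[OF _ _ Suc.IH integrand_integral_in_cell[OF assms]]) auto
  moreover have "cumulative_in_cell \<tau> n (\<tau> (Suc n)) + (area (t - real (Suc n) * eta) - area (\<tau> (Suc n) - real (Suc n) * eta)) = cumulative_in_cell \<tau> (Suc n) t"
    by (simp add: cumulative_in_cell_def gain_def jump_phase_def algebra_simps)
  ultimately show ?case by simp
qed

text \<open>Written as a Lebesgue integral, and not by cases on the number of jumps, so that it is visibly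
measurable in \<open>t\<close>.\<close>

definition cumulative :: "(nat \<Rightarrow> real) \<Rightarrow> real \<Rightarrow> real" where
  "cumulative \<tau> t = enn2real (\<integral>\<^sup>+x. (if 0 \<le> x \<and> x \<le> t then ennreal (integrand \<tau> x) else 0) \<partial>lborel)"

lemma integrand_nonneg: "0 \<le> integrand \<tau> x" by (simp add: integrand_def)

lemma cumulative_in_cell_nonneg: "admissible \<tau> \<Longrightarrow> \<tau> n \<le> t \<Longrightarrow> t \<le> \<tau> (Suc n) \<Longrightarrow> 0 \<le> cumulative_in_cell \<tau> n t"
  by (rule has_integral_nonneg[OF integrand_integral[of \<tau> n t]])
    (simp_all add: admissibleD(1,2) integrand_nonneg)

lemma nn_integral_integrand:
  assumes "admissible \<tau>" "\<tau> n \<le> t" "t \<le> \<tau> (Suc n)"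
  shows "(\<integral>\<^sup>+x. (if 0 \<le> x \<and> x \<le> t then ennreal (integrand \<tau> x) else 0) \<partial>lborel) = ennreal (cumulative_in_cell \<tau> n t)"
proof -
  have "(\<integral>\<^sup>+x. (if 0 \<le> x \<and> x \<le> t then ennreal (integrand \<tau> x) else 0) \<partial>lborel)
    = (\<integral>\<^sup>+x. ennreal (indicator {0..t} x * integrand \<tau> x) \<partial>lborel)"
    by (intro nn_integral_cong) auto
  also have "\<dots> = ennreal (cumulative_in_cell \<tau> n t)"
    by (rule nn_integral_has_integral_lebesgue) (use integrand_nonneg integrand_integral[of \<tau> n t] admissibleD(1,2)[of \<tau>] assms in auto)
  finally show ?thesis .
qed

lemma cumulative_eq:
  assumes "admissible \<tau>" "\<tau> n \<le> t" "t \<le> \<tau> (Suc n)"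
  shows "cumulative \<tau> t = cumulative_in_cell \<tau> n t"
  unfolding cumulative_def nn_integral_integrand[OF assms] using cumulative_in_cell_nonneg[OF assms] by simp

lemma integrand_measurable [measurable]: "integrand \<tau> \<in> borel_measurable borel"
  unfolding integrand_def[abs_def] K_fun_def[abs_def] by measurable

lemma cumulative_measurable [measurable]: "cumulative \<tau> \<in> borel_measurable borel"
  unfolding cumulative_def[abs_def] by measurable

section \<open>Slicing the weight\<close>

text \<open>Minus the derivative of \<open>1 / (pi\<^sup>2 * t\<^sup>2)\<close>, extended by \<open>0\<close> to \<open>t \<le> 0\<close>.\<close>

definition weight :: "real \<Rightarrow> real" where
  "weight t = (if 0 < t then 2 / (pi\<^sup>2 * t ^ 3) else 0)"

lemma weight_measurable [measurable]: "weight \<in> borel_measurable borel"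
  unfolding weight_def[abs_def] by measurable

lemma weight_nonneg: "0 \<le> weight t" by (simp add: weight_def)

lemma nn_integral_weight_tail:
  assumes "0 < x"
  shows "(\<integral>\<^sup>+t. ennreal (weight t) * indicator {x..} t \<partial>lborel) = ennreal (1 / (pi\<^sup>2 * x\<^sup>2))"
proof -
  have "(\<integral>\<^sup>+t. ennreal (weight t) * indicator {x..} t \<partial>lborel) = ennreal (0 - - (1 / (pi\<^sup>2 * x\<^sup>2)))"
  proof (rule nn_integral_FTC_atLeast)
    show "DERIV (\<lambda>t. - (1 / (pi\<^sup>2 * t\<^sup>2))) t :> weight t" if "x \<le> t" for t
      using that assms by (auto intro!: derivative_eq_intros simp: weight_def field_simps power2_eq_square power3_eq_cube)
    have "((\<lambda>t::real. - ((1 / pi\<^sup>2) * (inverse t)\<^sup>2)) \<longlongrightarrow> - ((1 / pi\<^sup>2) * 0\<^sup>2)) at_top"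
      by (intro tendsto_intros tendsto_inverse_0_at_top filterlim_ident)
    then show "((\<lambda>t. - (1 / (pi\<^sup>2 * t\<^sup>2))) \<longlongrightarrow> 0) at_top"
      by (simp add: field_simps power2_eq_square)
  qed (auto simp: weight_nonneg)
  then show ?thesis by simp
qed

text \<open>Express \<open>1 / (pi * x)\<^sup>2\<close> as the tail integral of \<open>weight\<close> and exchange the order of integration. After
this the functional is monotone in the function \<open>cumulative \<tau>\<close>.\<close>

lemma E_fun_layers:
  assumes "admissible \<tau>"
  shows "E_fun p \<tau> = (\<integral>\<^sup>+t. ennreal (weight t * cumulative \<tau> t) \<partial>lborel)"
proof -
  have "E_fun p \<tau> = (\<integral>\<^sup>+x. (\<integral>\<^sup>+t. (if 0 \<le> x \<and> x \<le> t then ennreal (weight t) * ennreal (integrand \<tau> x) else 0) \<partial>lborel) \<partial>lborel)"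
    unfolding E_fun_def
  proof (intro nn_integral_cong_AE, rule AE_mp[OF AE_lborel_singleton[of 0]], intro AE_I2 impI)
    fix x :: real assume x: "x \<noteq> 0"
    show "ennreal ((max 0 (K_fun p \<tau> x))\<^sup>2) * indicator {0..} x
      = (\<integral>\<^sup>+t. (if 0 \<le> x \<and> x \<le> t then ennreal (weight t) * ennreal (integrand \<tau> x) else 0) \<partial>lborel)"
    proof (cases "0 < x")
      case True
      have "(\<integral>\<^sup>+t. (if 0 \<le> x \<and> x \<le> t then ennreal (weight t) * ennreal (integrand \<tau> x) else 0) \<partial>lborel)
         = (\<integral>\<^sup>+t. ennreal (weight t) * indicator {x..} t * ennreal (integrand \<tau> x) \<partial>lborel)"
        using True by (intro nn_integral_cong) auto
      also have "\<dots> = ennreal (1 / (pi\<^sup>2 * x\<^sup>2)) * ennreal (integrand \<tau> x)"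
        by (simp add: nn_integral_multc nn_integral_weight_tail[OF True])
      also have "\<dots> = ennreal ((max 0 (K_fun p \<tau> x))\<^sup>2)"
        using True by (simp add: integrand_def power_mult_distrib flip: ennreal_mult)
      finally show ?thesis using True by simp
    qed (use x in auto)
  qed
  also have "\<dots> = (\<integral>\<^sup>+t. (\<integral>\<^sup>+x. (if 0 \<le> x \<and> x \<le> t then ennreal (weight t) * ennreal (integrand \<tau> x) else 0) \<partial>lborel) \<partial>lborel)"
    by (rule lborel_pair.Fubini'[symmetric]) measurable
  also have "\<dots> = (\<integral>\<^sup>+t. ennreal (weight t * cumulative \<tau> t) \<partial>lborel)"
  proof (intro nn_integral_cong)
    fix t :: real
    have "(\<integral>\<^sup>+x. (if 0 \<le> x \<and> x \<le> t then ennreal (weight t) * ennreal (integrand \<tau> x) else 0) \<partial>lborel)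
      = ennreal (weight t) * (\<integral>\<^sup>+x. (if 0 \<le> x \<and> x \<le> t then ennreal (integrand \<tau> x) else 0) \<partial>lborel)"
      by (subst nn_integral_cmult[symmetric]) (auto intro!: nn_integral_cong)
    also have "\<dots> = ennreal (weight t * cumulative \<tau> t)"
    proof (cases "0 < t")
      case True
      then obtain n where "\<tau> n \<le> t" "t < \<tau> (Suc n)" using admissible_cell[OF assms, of t] by auto
      then show ?thesis
        using nn_integral_integrand[OF assms, of n t] cumulative_eq[OF assms, of n t] cumulative_in_cell_nonneg[OF assms, of n t]
        by (simp add: ennreal_mult weight_nonneg)
    qed (simp add: weight_def)
    finally show "(\<integral>\<^sup>+x. (if 0 \<le> x \<and> x \<le> t then ennreal (weight t) * ennreal (integrand \<tau> x) else 0) \<partial>lborel)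
      = ennreal (weight t * cumulative \<tau> t)" .
  qed
  finally show ?thesis .
qed

section \<open>Comparison with the optimal sequence\<close>

definition opt_seq :: "nat \<Rightarrow> real" where
  "opt_seq n = (if n = 0 then 0 else real n - 1/2 + 3 / p)"

lemma opt_seq_Suc: "opt_seq (Suc j) = real (Suc j) * per + peak + real j * eta"
proof -
  have "3 / p = 3 / 4 * per" by (simp add: per_def)
  then have "opt_seq (Suc j) = real j * (per + eta) + (per + eta) / 2 + 3 / 4 * per"
    using eta_bounds by (simp add: opt_seq_def)
  then show ?thesis by (simp add: peak_def field_simps)
qed

lemma jump_phase_opt_seq: "jump_phase opt_seq j = peak + real (Suc j) * per"
  by (simp add: jump_phase_def opt_seq_Suc)

lemma gain_jump_phase_opt_seq: "gain (jump_phase opt_seq j) = max_gain"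
  unfolding jump_phase_opt_seq gain_periodic_nat max_gain_def ..

lemma opt_seq_in_T_seqs:
  assumes "\<delta>\<^sub>1 \<le> 1/2 + 3/p" "\<delta>\<^sub>2 \<le> 1" shows "opt_seq \<in> T_seqs \<delta>\<^sub>1 \<delta>\<^sub>2"
proof -
  have "0 < 3 / p" using p_gt by simp
  then have "0 < 1 / 2 + 3 / p" by linarith
  then have "opt_seq n < opt_seq (Suc n)" for n by (simp add: opt_seq_def)
  then have "strict_mono opt_seq" by (simp add: strict_mono_Suc_iff)
  then show ?thesis using assms by (simp add: T_seqs_def opt_seq_def)
qed

lemma admissible_opt_seq: "admissible opt_seq"
  unfolding admissible_def using per_bounds p_gt by (intro opt_seq_in_T_seqs) auto

lemma cumulative_in_cell_opt_seq: "cumulative_in_cell opt_seq m t = area (t - real m * eta) + real m * max_gain"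
  by (simp add: cumulative_in_cell_def gain_jump_phase_opt_seq)

lemma area_drop: "area u - area (u - real k * eta) = (\<Sum>i<k. gain (u - real i * eta))"
proof (induction k)
  case (Suc k)
  have "area (u - real k * eta) - area (u - real (Suc k) * eta) = gain (u - real k * eta)"
    by (simp add: gain_def algebra_simps)
  then show ?case using Suc by simp
qed simp

text \<open>The optimal sequence has made \<open>m - n\<close> more jumps. Its phase lags by as many windows of length \<open>eta\<close>, each
of area at most \<open>max_gain\<close>, and each of its additional jumps earns \<open>max_gain\<close>.\<close>

lemma cumulative_in_cell_diff_fewer:
  assumes "n \<le> m"
  shows "(\<Sum>j<n. max_gain - gain (jump_phase \<tau> j)) \<le> cumulative_in_cell opt_seq m t - cumulative_in_cell \<tau> n t"
proof -
  define u where "u = t - real n * eta"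
  have "area u - area (u - real (m - n) * eta) \<le> real (m - n) * max_gain"
    unfolding area_drop using sum_bounded_above[of "{..<m - n}" "\<lambda>i. gain (u - real i * eta)" max_gain] gain_le by simp
  moreover have "u - real (m - n) * eta = t - real m * eta"
    using assms by (simp add: u_def of_nat_diff algebra_simps)
  moreover have "real (m - n) * max_gain = real m * max_gain - real n * max_gain"
    using assms by (simp add: of_nat_diff algebra_simps)
  ultimately show ?thesis
    unfolding cumulative_in_cell_opt_seq unfolding cumulative_in_cell_def sum_subtractf u_def[symmetric] by simp
qed

lemma cumulative_in_cell_diff_more:
  assumes "m \<le> n"
  shows "cumulative_in_cell opt_seq m t - cumulative_in_cell \<tau> n t
    = real m * max_gain + (\<Sum>i<n - m. gain (t - real m * eta - real i * eta)) - (\<Sum>j<n. gain (jump_phase \<tau> j))"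
proof -
  have "t - real m * eta - real (n - m) * eta = t - real n * eta"
    using assms by (simp add: of_nat_diff algebra_simps)
  then show ?thesis
    unfolding area_drop[symmetric] cumulative_in_cell_opt_seq by (simp only: cumulative_in_cell_def)
qed

lemma jump_phase_le_phase:
  assumes "admissible \<tau>" "\<tau> n \<le> t" "j < n"
  shows "jump_phase \<tau> j \<le> t - real (n - 1) * eta"
proof -
  have "jump_phase \<tau> i \<le> jump_phase \<tau> (Suc i)" for i using admissibleD(4)[OF assms(1), of i] per_bounds by linarith
  then have "jump_phase \<tau> j \<le> jump_phase \<tau> (n - 1)"
    using lift_Suc_mono_le[of "jump_phase \<tau>" j "n - 1"] assms(3) by auto
  also have "\<dots> \<le> t - real (n - 1) * eta" using assms by (simp add: jump_phase_def)
  finally show ?thesis .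
qed

lemma opt_seq_cell_phase: "t < opt_seq (Suc m) \<Longrightarrow> t - real m * eta \<le> real (Suc m) * per + peak"
  by (simp add: opt_seq_Suc)

lemma gain_last_le_sum:
  assumes "m < n"
  shows "gain (t - real (n - 1) * eta) \<le> (\<Sum>i<n - m. gain (t - real m * eta - real i * eta))"
proof -
  have "gain (t - real m * eta - real (n - 1 - m) * eta) \<le> (\<Sum>i<n - m. gain (t - real m * eta - real i * eta))"
    using member_le_sum[of "n - 1 - m" "{..<n - m}" "\<lambda>i. gain (t - real m * eta - real i * eta)"]
      assms gain_nonneg by simp
  moreover have "t - real m * eta - real (n - 1 - m) * eta = t - real (n - 1) * eta"
    using assms by (simp add: of_nat_diff algebra_simps)
  ultimately show ?thesis by (simp only:)
qed

text \<open>A first jump later than \<open>per\<close> lies beyond the initial half wave, so \<open>spaced_sum_le\<close> applies to all jumps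
of \<open>\<tau>\<close> when \<open>\<tau>\<close> has jumped more often than the optimal sequence.\<close>

lemma cumulative_le_opt_seq:
  assumes "admissible \<tau>" "per < \<tau> 1" "0 \<le> t"
  shows "cumulative \<tau> t \<le> cumulative opt_seq t"
proof -
  obtain n where n: "\<tau> n \<le> t" "t < \<tau> (Suc n)" using admissible_cell[OF assms(1,3)] .
  obtain m where m: "opt_seq m \<le> t" "t < opt_seq (Suc m)" using admissible_cell[OF admissible_opt_seq assms(3)] .
  have "cumulative_in_cell \<tau> n t \<le> cumulative_in_cell opt_seq m t"
  proof (cases "n \<le> m")
    case True
    have "0 \<le> (\<Sum>j<n. max_gain - gain (jump_phase \<tau> j))" using gain_le by (intro sum_nonneg) auto
    then show ?thesis using cumulative_in_cell_diff_fewer[OF True, of \<tau> t] by linarith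
  next
    case False
    have "(\<Sum>j<n. gain (jump_phase \<tau> j)) \<le> real m * max_gain + gain (t - real (n - 1) * eta)"
    proof (rule spaced_sum_le)
      show "per / 2 + eta \<le> jump_phase \<tau> 0"
        using assms(2) eta_bounds per_bounds by (simp add: jump_phase_def)
      have "real m * eta \<le> real (n - 1) * eta" using False eta_bounds by (intro mult_right_mono) auto
      then show "t - real (n - 1) * eta \<le> real (Suc m) * per + peak"
        using opt_seq_cell_phase[OF m(2)] by linarith
    qed (use admissibleD(4)[OF assms(1)] jump_phase_le_phase[OF assms(1) n(1)] in auto)
    then show ?thesis using cumulative_in_cell_diff_more[of m n t \<tau>] gain_last_le_sum[of m n t] False by linarith
  qed
  then show ?thesis using cumulative_eq[OF assms(1)] cumulative_eq[OF admissible_opt_seq] n m by simp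
qed

lemma gain_less_shift:
  assumes "peak + real k * per < a" "a < peak + real (Suc k) * per" shows "gain a < max_gain"
  using gain_less[of "a - real k * per"] gain_periodic_nat[of "a - real k * per" k] assms
  by (simp add: algebra_simps)

text \<open>Consider the first index at which the sequences differ, and times shortly after the optimal jump with
that index. If \<open>\<tau>\<close> has not yet jumped, the optimal sequence leads by \<open>max_gain\<close> less the gain at a phase past
the optimum. If \<open>\<tau>\<close> jumped earlier, its phase was less than a period before the optimal one, so its gain
was smaller; the spacing keeps its next jump from having happened already.\<close>

lemma cumulative_less_opt_seq:
  assumes "admissible \<tau>" "per < \<tau> 1" "\<tau> \<noteq> opt_seq"
  obtains a b where "0 < a" "a < b" "\<And>t. a < t \<Longrightarrow> t < b \<Longrightarrow> cumulative \<tau> t < cumulative opt_seq t"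
proof -
  define k where "k = (LEAST k. \<tau> k \<noteq> opt_seq k)"
  obtain k0 where "\<tau> k0 \<noteq> opt_seq k0" using assms(3) by auto
  then have k: "\<tau> k \<noteq> opt_seq k" unfolding k_def by (rule LeastI)
  have same: "\<tau> i = opt_seq i" if "i < k" for i
    using not_less_Least[of i "\<lambda>k. \<tau> k \<noteq> opt_seq k"] that by (auto simp: k_def)
  obtain j where j: "k = Suc j" using k admissibleD(2)[OF assms(1)] by (cases k) (auto simp: opt_seq_def)
  have th_same: "jump_phase \<tau> i = jump_phase opt_seq i" if "i < j" for i
    using same[of "Suc i"] that j by (simp add: jump_phase_def)
  have pos: "0 < opt_seq (Suc j)" using admissibleD(1,2)[OF admissible_opt_seq] strict_monoD[of opt_seq 0 "Suc j"] by simp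
  have next_opt_seq: "opt_seq (Suc j) < opt_seq (Suc (Suc j))"
    using strict_monoD[OF admissibleD(1)[OF admissible_opt_seq], of "Suc j" "Suc (Suc j)"] by simp
  consider "opt_seq (Suc j) < \<tau> (Suc j)" | "\<tau> (Suc j) < opt_seq (Suc j)"
    using k unfolding j by linarith
  then show thesis
  proof cases
    case 1
    define b where "b = min (\<tau> (Suc j)) (min (opt_seq (Suc (Suc j))) (opt_seq (Suc j) + per))"
    have "opt_seq (Suc j) < b" using 1 next_opt_seq per_bounds by (simp add: b_def)
    moreover have "cumulative \<tau> t < cumulative opt_seq t" if t: "opt_seq (Suc j) < t" "t < b" for t
    proof -
      have "\<tau> j \<le> opt_seq (Suc j)"
        using same[of j] j strict_monoD[OF admissibleD(1)[OF admissible_opt_seq], of j "Suc j"] by simp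
      then have "cumulative \<tau> t = cumulative_in_cell \<tau> j t" using t by (intro cumulative_eq[OF assms(1)]) (auto simp: b_def)
      moreover have "cumulative opt_seq t = cumulative_in_cell opt_seq (Suc j) t" using t by (intro cumulative_eq[OF admissible_opt_seq]) (auto simp: b_def)
      moreover have "cumulative_in_cell \<tau> j t = cumulative_in_cell opt_seq j t" using th_same by (simp add: cumulative_in_cell_def)
      moreover have "cumulative_in_cell opt_seq (Suc j) t - cumulative_in_cell opt_seq j t = max_gain - gain (t - real j * eta)"
        by (simp add: cumulative_in_cell_opt_seq gain_def algebra_simps)
      moreover have "gain (t - real j * eta) < max_gain"
        by (rule gain_less_shift[of "Suc j"]) (use t in \<open>auto simp: b_def opt_seq_Suc algebra_simps\<close>)
      ultimately show ?thesis by linarith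
    qed
    ultimately show thesis using that[OF pos] by blast
  next
    case 2
    have th_lt: "jump_phase \<tau> j < peak + real (Suc j) * per" using 2 by (simp add: jump_phase_def opt_seq_Suc)
    have th_gt: "peak + real j * per < jump_phase \<tau> j"
    proof (cases j)
      case 0
      then show ?thesis using assms(2) peak_bounds per_bounds by (simp add: jump_phase_def)
    next
      case (Suc i)
      then show ?thesis
        using admissibleD(4)[OF assms(1), of i] th_same[of i] per_bounds by (simp add: jump_phase_opt_seq)
    qed
    have late: "opt_seq (Suc j) < \<tau> (Suc (Suc j))"
    proof -
      have "peak + real (Suc j) * per \<le> jump_phase \<tau> (Suc j)"
      proof (cases j)
        case 0
        then show ?thesis using assms(2) peak_bounds admissibleD(4)[OF assms(1), of 0] by (simp add: jump_phase_def)
      next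
        case (Suc i)
        then show ?thesis
          using admissibleD(4)[OF assms(1), of i] admissibleD(4)[OF assms(1), of j] th_same[of i]
          by (simp add: jump_phase_opt_seq algebra_simps)
      qed
      then show ?thesis using eta_bounds by (simp add: jump_phase_def opt_seq_Suc algebra_simps)
    qed
    define b where "b = min (\<tau> (Suc (Suc j))) (opt_seq (Suc (Suc j)))"
    have "opt_seq (Suc j) < b" using late next_opt_seq by (simp add: b_def)
    moreover have "cumulative \<tau> t < cumulative opt_seq t" if t: "opt_seq (Suc j) < t" "t < b" for t
    proof -
      have "cumulative \<tau> t = cumulative_in_cell \<tau> (Suc j) t" using t 2 by (intro cumulative_eq[OF assms(1)]) (auto simp: b_def)
      moreover have "cumulative opt_seq t = cumulative_in_cell opt_seq (Suc j) t" using t by (intro cumulative_eq[OF admissible_opt_seq]) (auto simp: b_def)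
      moreover have "max_gain - gain (jump_phase \<tau> j) \<le> (\<Sum>i<Suc j. max_gain - gain (jump_phase \<tau> i))"
        using gain_le by (intro member_le_sum[of j "{..<Suc j}" "\<lambda>i. max_gain - gain (jump_phase \<tau> i)"]) auto
      moreover have "gain (jump_phase \<tau> j) < max_gain" by (rule gain_less_shift[OF th_gt th_lt])
      ultimately show ?thesis using cumulative_in_cell_diff_fewer[of "Suc j" "Suc j" \<tau> t] by linarith
    qed
    ultimately show thesis using that[OF pos] by blast
  qed
qed

lemma cumulative_nonneg: "0 \<le> cumulative \<tau> t" by (simp add: cumulative_def)

lemma cumulative_le: assumes "admissible \<tau>" "0 \<le> t" shows "cumulative \<tau> t \<le> t"
proof -
  obtain n where n: "\<tau> n \<le> t" "t < \<tau> (Suc n)" using admissible_cell[OF assms] .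
  have "cumulative_in_cell \<tau> n t \<le> t"
  proof (rule has_integral_le[OF integrand_integral[of \<tau> n t]])
    show "((\<lambda>_. 1) has_integral t) {0..t}" using has_integral_const_real[of "1::real" 0 t] assms by simp
    fix x assume x: "x \<in> {0..t}"
    obtain k where k: "\<tau> k \<le> x" "x < \<tau> (Suc k)" using admissible_cell[OF assms(1)] x by auto
    show "integrand \<tau> x \<le> 1"
    proof (cases "\<tau> k = x")
      case True
      then have "indicator {\<tau> i<..<\<tau> (i + 1)} x = (0::real)" for i
        using strict_mono_less[OF admissibleD(1)[OF assms(1)]] by auto
      then have "integrand \<tau> x = 0" by (simp add: integrand_def K_fun_def)
      then show ?thesis by simp
    next
      case False
      then show ?thesis using integrand_cell[OF admissibleD(1,2)[OF assms(1)], of k x] assms(1) k hump_le_1 by simp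
    qed
  qed (use n admissibleD(1,2)[OF assms(1)] in auto)
  then show ?thesis using cumulative_eq[OF assms(1)] n by simp
qed

lemma cumulative_initial: assumes "admissible \<tau>" "0 \<le> t" "t \<le> 1/2" shows "cumulative \<tau> t = area t"
  using cumulative_eq[OF assms(1), of 0 t] admissibleD(2,3)[OF assms(1)] assms by (simp add: jump_phase_def cumulative_in_cell_def)

text \<open>Near \<open>0\<close> the weight is not integrable by itself, but \<open>cumulative \<tau> t\<close> is of order \<open>t\<^sup>3\<close> there; elsewhere
\<open>cumulative \<tau> t \<le> t\<close> suffices.\<close>

lemma E_fun_finite: assumes "admissible \<tau>" shows "E_fun p \<tau> < \<infinity>"
proof -
  have "E_fun p \<tau> \<le> (\<integral>\<^sup>+t. ennreal (2 / pi\<^sup>2 * omega\<^sup>2) * indicator {0..1/2} t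
      + ennreal (2 / (pi\<^sup>2 * t\<^sup>2)) * indicator {1/2..} t \<partial>lborel)"
    unfolding E_fun_layers[OF assms]
  proof (intro nn_integral_mono)
    fix t :: real
    consider "t \<le> 0" | "0 < t" "t \<le> 1/2" | "1/2 < t" by linarith
    then show "ennreal (weight t * cumulative \<tau> t) \<le> ennreal (2 / pi\<^sup>2 * omega\<^sup>2) * indicator {0..1/2} t
      + ennreal (2 / (pi\<^sup>2 * t\<^sup>2)) * indicator {1/2..} t"
    proof cases
      case 2
      obtain z where z: "0 < z" "z < t" "area t - area 0 = (t - 0) * hump z"
        using MVT2[of 0 t area hump] area_deriv 2 by blast
      have "\<bar>max 0 (sin (omega * z))\<bar> \<le> \<bar>omega * t\<bar>"
      proof -
        have "\<bar>sin (omega * z)\<bar> \<le> \<bar>omega * z\<bar>" by (rule abs_sin_x_le_abs_x)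
        also have "\<dots> \<le> \<bar>omega * t\<bar>" using omega_pos z by (simp add: abs_mult)
        finally show ?thesis by (simp add: abs_if max_def split: if_splits)
      qed
      then have "hump z \<le> (omega * t)\<^sup>2" unfolding hump_def by (simp flip: abs_le_square_iff)
      then have "cumulative \<tau> t \<le> t * (omega * t)\<^sup>2"
        using z 2 cumulative_initial[OF assms, of t] area_0 by (simp add: mult_left_mono)
      then have "weight t * cumulative \<tau> t \<le> weight t * (t * (omega * t)\<^sup>2)"
        by (intro mult_left_mono weight_nonneg)
      also have "\<dots> = 2 / pi\<^sup>2 * omega\<^sup>2"
        using 2 by (simp add: weight_def power2_eq_square power3_eq_cube)
      finally show ?thesis using 2 by (intro add_increasing2) (auto intro: ennreal_leI)
    next
      case 3
      have "weight t * cumulative \<tau> t \<le> weight t * t"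
        using 3 cumulative_le[OF assms, of t] by (intro mult_left_mono weight_nonneg) auto
      also have "\<dots> = 2 / (pi\<^sup>2 * t\<^sup>2)"
        using 3 by (simp add: weight_def power2_eq_square power3_eq_cube)
      finally show ?thesis using 3 by (intro add_increasing) (auto intro: ennreal_leI)
    qed (simp add: weight_def)
  qed
  also have "\<dots> = ennreal (2 / pi\<^sup>2 * omega\<^sup>2) * emeasure lborel {0..1/2 :: real}
      + (\<integral>\<^sup>+t. ennreal (2 / (pi\<^sup>2 * t\<^sup>2)) * indicator {1/2..} t \<partial>lborel)"
    by (subst nn_integral_add) (auto simp: nn_integral_cmult)
  also have "(\<integral>\<^sup>+t. ennreal (2 / (pi\<^sup>2 * t\<^sup>2)) * indicator {1/2..} t \<partial>lborel) = ennreal (0 - - (2 / (pi\<^sup>2 * (1/2))))"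
  proof (rule nn_integral_FTC_atLeast)
    show "DERIV (\<lambda>t. - (2 / (pi\<^sup>2 * t))) t :> 2 / (pi\<^sup>2 * t\<^sup>2)" if "1/2 \<le> t" for t
      using that by (auto intro!: derivative_eq_intros simp: field_simps power2_eq_square)
    have "((\<lambda>t::real. - ((2 / pi\<^sup>2) * inverse t)) \<longlongrightarrow> - ((2 / pi\<^sup>2) * 0)) at_top"
      by (intro tendsto_intros tendsto_inverse_0_at_top filterlim_ident)
    then show "((\<lambda>t. - (2 / (pi\<^sup>2 * t))) \<longlongrightarrow> 0) at_top" by (simp add: field_simps)
  qed auto
  also have "emeasure lborel {0..1/2 :: real} = ennreal (1/2)" by simp
  also have "ennreal (2 / pi\<^sup>2 * omega\<^sup>2) * ennreal (1/2) + ennreal (0 - - (2 / (pi\<^sup>2 * (1/2))))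
    = ennreal (2 / pi\<^sup>2 * omega\<^sup>2 * (1/2) + (0 - - (2 / (pi\<^sup>2 * (1/2)))))"
    by (subst ennreal_plus, simp, simp, subst ennreal_mult) auto
  finally show ?thesis by (rule order.strict_trans1) simp
qed

section \<open>A premature first jump\<close>

text \<open>The phase \<open>1/2 = per / 2 + eta / 2\<close> is the earliest at which an admissible sequence can jump, and past
\<open>per / 2\<close> the gain decreases up to \<open>per\<close>; so this is the most that a jump before \<open>per\<close> can earn.\<close>

definition early_gain :: real where "early_gain = gain (1/2)"

lemma gain_at_half: "early_gain = eta / 4 - sin (omega * eta) / (4 * omega)"
proof -
  have "gain (eta / 2) = sin2_area (eta / 2)"
    using area_on_hump[of "eta/2"] area_before_hump[of "- (eta/2)"] eta_bounds per_bounds by (simp add: gain_def)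
  moreover have "eta / 2 + per / 2 = 1 / 2" using eta_bounds by simp
  ultimately show ?thesis
    using gain_pair[of "eta / 2", unfolded \<open>eta / 2 + per / 2 = 1 / 2\<close>]
    by (simp add: early_gain_def sin2_area_def field_simps)
qed

lemma max_gain_plus_early_gain: "max_gain + 2 * early_gain = eta"
  using omega_pos by (simp add: max_gain_eq gain_at_half field_simps)

text \<open>The midpoint of the interval on which \<open>bump\<close> below is supported.\<close>

definition bump_centre :: real where "bump_centre = per + peak + eta / 2"

lemma bump_centre_eq: "bump_centre = (5 - eta) / 4"
  using eta_bounds by (simp add: bump_centre_def peak_def field_simps)

text \<open>After division by \<open>pi\<^sup>2 * bump_centre ^ 3\<close> the left-hand side is \<open>early_gain\<close> times the total weight of
\<open>[1/2, \<infinity>)\<close>, and the right-hand side is the lower bound for the loss from \<open>bump_weighted_ge\<close>. In terms of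
\<open>r = 4 * early_gain / eta\<close> it becomes the polynomial inequality in \<open>r\<close> and \<open>eta\<close> proved in two ranges of
\<open>eta\<close>.\<close>

lemma early_gain_small: "4 * early_gain * bump_centre ^ 3 < 2 * (eta * (per / 4 + max_gain))"
proof -
  define y where "y = omega * eta"
  define r where "r = 1 - sin y / y"
  have y: "0 < y" "y \<le> pi / 2" using omega_eta by (auto simp: y_def)
  have early_gain: "4 * early_gain = eta * r"
    using omega_pos eta_bounds by (simp add: gain_at_half r_def y_def field_simps)
  have max_gain: "max_gain = eta - eta * r / 2" using early_gain max_gain_plus_early_gain by simp
  have per: "per = 1 - eta" using eta_bounds by simp
  have "r * (5 - eta) ^ 3 < 128 * (1/4 + 3/4 * eta - eta * r / 2)"
  proof (cases "eta \<le> 3/20")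
    case True
    have "omega * per = omega - omega * eta" by (simp add: per algebra_simps)
    then have "omega * (17/20) \<le> 2 * pi" using omega_per True omega_pos mult_left_mono[of eta "3/20" omega] by simp
    then have "y \<le> 40/17 * pi * (3/20)"
      unfolding y_def using True eta_bounds omega_pos by (intro mult_mono) auto
    also have "\<dots> \<le> 6/5" using pi_approx by simp
    finally have r: "r \<le> 1/4" unfolding r_def by (rule sin_deficit_bounds(1)[OF y(1)])
    have "(5 - eta) ^ 3 \<le> 5 ^ 3" using eta_bounds by (intro power_mono) auto
    then have "r * (5 - eta) ^ 3 \<le> 1/4 * 5 ^ 3"
      using r eta_bounds by (intro mult_mono) auto
    moreover have "eta * r \<le> eta * (1/4)" using r eta_bounds by (intro mult_left_mono) auto
    moreover have "r * (5 - eta) ^ 3 \<le> 125 / 4" using calculation by simp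
    ultimately show ?thesis using eta_bounds unfolding distrib_left right_diff_distrib by linarith
  next
    case False
    have r: "r \<le> 37/100" unfolding r_def by (rule sin_deficit_bounds(2)[OF y])
    have "(5 - eta) ^ 3 \<le> (97/20) ^ 3" using False eta_bounds by (intro power_mono) auto
    then have "r * (5 - eta) ^ 3 \<le> 37/100 * (97/20) ^ 3"
      using r eta_bounds by (intro mult_mono) auto
    moreover have "eta * r \<le> eta * (37/100)" using r eta_bounds by (intro mult_left_mono) auto
    moreover have "37/100 * (97/20) ^ 3 \<le> (423/10 :: real)" by (simp add: power3_eq_cube)
    ultimately show ?thesis using False unfolding distrib_left right_diff_distrib by linarith
  qed
  then have "eta * (r * (5 - eta) ^ 3) < eta * (128 * (1/4 + 3/4 * eta - eta * r / 2))"
    using eta_bounds by (intro mult_strict_left_mono) auto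
  then show ?thesis
    unfolding early_gain bump_centre_eq max_gain per by (simp add: power_divide field_simps)
qed

lemma gain_reflect: "gain (2 * peak - a) = gain a"
proof -
  have hump_sym: "hump (per / 2 - u) = hump u" for u
  proof -
    have "omega * (per / 2 - u) = pi - omega * u" using omega_half by (simp add: algebra_simps)
    then show ?thesis by (simp add: hump_def)
  qed
  have "(\<lambda>u. area (per / 2 - u) + area u) (a - eta) = (\<lambda>u. area (per / 2 - u) + area u) a"
    by (rule DERIV_isconst_all) (auto intro!: derivative_eq_intros simp: hump_sym)
  then show ?thesis by (simp add: gain_def peak_def algebra_simps)
qed

text \<open>The optimal sequence runs through its second positive stretch between \<open>per\<close> and \<open>per + 2 * peak\<close>.
The function \<open>bump t\<close> is the area collected there up to time \<open>t\<close>, less the area that the same stretch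
yields when it is delayed by \<open>eta\<close>.\<close>

definition bump :: "real \<Rightarrow> real" where
  "bump t = (if t < per \<or> 2 * bump_centre - per < t then 0 else if t \<le> per + peak then gain t
     else if t < per + peak + eta then max_gain else gain (t - eta))"

lemma bump_nonneg: "0 \<le> bump t" using gain_nonneg max_gain_pos by (simp add: bump_def)

lemma bump_le: "bump t \<le> max_gain" using gain_le max_gain_pos by (simp add: bump_def)

lemma bump_reflect: "bump (2 * bump_centre - t) = bump t"
proof -
  have e2: "gain (2 * per + 2 * peak - u) = gain u" for u
    using gain_reflect[of "u - 2 * per"] gain_periodic[of "u - per"] gain_periodic[of "u - 2 * per"]
    by (simp add: algebra_simps)
  have eL: "gain (per + peak) = max_gain" using gain_periodic[of peak] by (simp add: max_gain_def add.commute)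
  have "2 * bump_centre = 2 * per + 2 * peak + eta" by (simp add: bump_centre_def)
  then show ?thesis
    using e2[of t] e2[of "t - eta"] eL eta_bounds by (auto simp: bump_def algebra_simps)
qed

lemma bump_measurable [measurable]: "bump \<in> borel_measurable borel"
proof -
  have [measurable]: "gain \<in> borel_measurable borel"
    by (rule borel_measurable_continuous_onI) (auto intro: continuous_intros)
  show ?thesis unfolding bump_def[abs_def] by measurable
qed

text \<open>If the first jump happens by time \<open>per\<close>, its gain is at most \<open>early_gain\<close>. The later jumps start beyond the
initial half wave, so \<open>spaced_sum_le\<close> applies to them. With the gain of the first jump set apart, only
the delay that it caused remains, and \<open>\<tau>\<close> trails by at least \<open>bump t\<close>.\<close>

lemma cumulative_early_jump:
  assumes "admissible \<tau>" "\<tau> 1 \<le> per" "0 \<le> t"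
  shows "cumulative \<tau> t + bump t \<le> cumulative opt_seq t + (if 1/2 \<le> t then early_gain else 0)"
proof -
  have kap0: "0 \<le> early_gain" by (simp add: early_gain_def gain_nonneg)
  show ?thesis
  proof (cases "1/2 \<le> t")
    case False
    then show ?thesis
      using cumulative_initial[OF assms(1,3)] cumulative_initial[OF admissible_opt_seq assms(3)] per_bounds by (simp add: bump_def)
  next
    case late: True
    have first: "gain (jump_phase \<tau> 0) \<le> early_gain"
      unfolding early_gain_def using admissibleD(3)[OF assms(1)] assms(2) eta_bounds
      by (intro gain_antimono) (auto simp: jump_phase_def)
    obtain n where n: "\<tau> n \<le> t" "t < \<tau> (Suc n)" using admissible_cell[OF assms(1,3)] .
    obtain m where m: "opt_seq m \<le> t" "t < opt_seq (Suc m)" using admissible_cell[OF admissible_opt_seq assms(3)] .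
    have m0: "m = 0" if "t < per + peak"
    proof (rule ccontr)
      assume "m \<noteq> 0"
      then have "opt_seq 1 \<le> opt_seq m" using strict_mono_less_eq[OF admissibleD(1)[OF admissible_opt_seq], of 1 m] by simp
      then show False using m that opt_seq_Suc[of 0] by simp
    qed
    have n_pos: "0 < n" if "per \<le> t"
      using that n assms(2) by (cases n) auto
    have sum_shift: "(\<Sum>j<n. gain (jump_phase \<tau> j)) = gain (jump_phase \<tau> 0) + (\<Sum>j<n - 1. gain (jump_phase \<tau> (Suc j)))" if "0 < n"
      using that sum.lessThan_Suc_shift[of "\<lambda>j. gain (jump_phase \<tau> j)" "n - 1"] by simp
    (* y is the phase that \<tau> would have at time t without its last setback; below, u is the phase
       of the optimal sequence at time t, and S is the area between u and the phase of \<tau>. *)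
    define y where "y = t - real (n - 1) * eta"
    have chain: "(\<Sum>j<n - 1. gain (jump_phase \<tau> (Suc j))) \<le> real k * max_gain + gain y"
      if "y \<le> real (Suc k) * per + peak" for k
    proof (rule spaced_sum_le)
      show "per / 2 + eta \<le> jump_phase \<tau> (Suc 0)"
        using admissibleD(3)[OF assms(1)] admissibleD(4)[OF assms(1), of 0] per_bounds eta_bounds by linarith
      show "\<forall>j<n - 1. jump_phase \<tau> (Suc j) \<le> y"
        unfolding y_def using jump_phase_le_phase[OF assms(1) n(1)] by simp
    qed (use admissibleD(4)[OF assms(1)] that in auto)
    have "cumulative_in_cell \<tau> n t + bump t \<le> cumulative_in_cell opt_seq m t + early_gain"
    proof (cases "n \<le> m")
      case True
      show ?thesis
      proof (cases "t < per")
        case True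
        have "0 \<le> (\<Sum>j<n. max_gain - gain (jump_phase \<tau> j))" using gain_le by (intro sum_nonneg) auto
        then show ?thesis
          using cumulative_in_cell_diff_fewer[OF \<open>n \<le> m\<close>, of \<tau> t] True kap0 by (simp add: bump_def)
      next
        case False
        then have "max_gain - gain (jump_phase \<tau> 0) \<le> (\<Sum>j<n. max_gain - gain (jump_phase \<tau> j))"
          using n_pos gain_le by (intro member_le_sum[of 0 "{..<n}" "\<lambda>j. max_gain - gain (jump_phase \<tau> j)"]) auto
        then show ?thesis
          using cumulative_in_cell_diff_fewer[OF \<open>n \<le> m\<close>, of \<tau> t] first bump_le[of t] by linarith
      qed
    next
      case False
      define u where "u = t - real m * eta"
      define S where "S = (\<Sum>i<n - m. gain (u - real i * eta))"
      have npos: "0 < n" using False by simp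
      have y_le: "y \<le> t - real m * eta"
      proof -
        have "real m * eta \<le> real (n - 1) * eta" using False eta_bounds by (intro mult_right_mono) auto
        then show ?thesis by (simp add: y_def)
      qed
      then have ym: "y \<le> real (Suc m) * per + peak" using opt_seq_cell_phase[OF m(2)] by linarith
      have S1: "gain y \<le> S" using gain_last_le_sum[of m n t] False by (simp add: S_def u_def y_def)
      have S2: "gain u + gain y \<le> S" if "Suc m < n"
      proof -
        define q where "q = n - m - 2"
        have q: "n - m = Suc (Suc q)" using that by (simp add: q_def)
        have "S = gain u + (\<Sum>i<q. gain (u - real (Suc i) * eta)) + gain (u - real (Suc q) * eta)"
          unfolding S_def q sum.lessThan_Suc[of _ "Suc q"] sum.lessThan_Suc_shift[of _ q] by simp
        moreover have "u - real (Suc q) * eta = y"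
          using that by (simp add: u_def y_def q_def of_nat_diff algebra_simps)
        moreover have "0 \<le> (\<Sum>i<q. gain (u - real (Suc i) * eta))" by (intro sum_nonneg gain_nonneg)
        ultimately show ?thesis by simp
      qed
      have "bump t + (\<Sum>j<n - 1. gain (jump_phase \<tau> (Suc j))) \<le> real m * max_gain + S"
      proof -
        consider "t < per \<or> 2 * bump_centre - per < t" | "per \<le> t" "t < per + peak"
          | "per + peak \<le> t" "t < per + peak + eta" | "per + peak + eta \<le> t" "t \<le> 2 * bump_centre - per" by linarith
        then show ?thesis
        proof cases
          case 1
          then show ?thesis using chain[OF ym] S1 by (auto simp: bump_def)
        next
          case 2
          have m: "m = 0" using m0 2 by simp
          have B: "bump t = gain u" using 2 m peak_bounds eta_bounds by (simp add: bump_def bump_centre_def u_def)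
          show ?thesis
          proof (cases "n = 1")
            case True
            then show ?thesis using m by (simp add: B S_def)
          next
            case False
            then have "Suc m < n" using m npos by simp
            then show ?thesis using S2 chain[OF ym] B by linarith
          qed
        next
          case 3
          have m1: "m = 1"
          proof -
            have "opt_seq 1 < opt_seq (Suc m)" "opt_seq m < opt_seq 2"
              using 3 m eta_bounds per_bounds peak_bounds opt_seq_Suc[of 0] opt_seq_Suc[of 1] by (auto simp: numeral_2_eq_2)
            then have "1 < Suc m" "m < 2" using strict_mono_less[OF admissibleD(1)[OF admissible_opt_seq]] by auto
            then show ?thesis by simp
          qed
          have "y \<le> real (Suc 0) * per + peak" using y_le m1 3 by simp
          from chain[OF this] show ?thesis using m1 S1 bump_le[of t] by simp
        next
          case 4
          have m1: "m = 1"
          proof -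
            have "opt_seq 1 < opt_seq (Suc m)" "opt_seq m < opt_seq 2"
              using 4 m eta_bounds per_bounds peak_bounds opt_seq_Suc[of 0] opt_seq_Suc[of 1]
              by (auto simp: numeral_2_eq_2 bump_centre_def)
            then have "1 < Suc m" "m < 2" using strict_mono_less[OF admissibleD(1)[OF admissible_opt_seq]] by auto
            then show ?thesis by simp
          qed
          have B: "bump t = gain u" using 4 m1 peak_bounds eta_bounds by (auto simp: bump_def bump_centre_def u_def)
          show ?thesis
          proof (cases "n = 2")
            case True
            then show ?thesis using m1 gain_le[of "jump_phase \<tau> (Suc 0)"] by (simp add: B S_def)
          next
            case False
            then have "Suc m < n" using m1 \<open>\<not> n \<le> m\<close> by simp
            then show ?thesis using S2 chain[OF ym] B by linarith
          qed
        qed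
      qed
      moreover have "cumulative_in_cell opt_seq m t - cumulative_in_cell \<tau> n t = real m * max_gain + S - (\<Sum>j<n. gain (jump_phase \<tau> j))"
        using cumulative_in_cell_diff_more[of m n t \<tau>] False by (simp add: S_def u_def)
      ultimately show ?thesis using sum_shift[OF npos] first by linarith
    qed
    then show ?thesis using cumulative_eq[OF assms(1)] cumulative_eq[OF admissible_opt_seq] n m late by simp
  qed
qed

text \<open>Integrating the elementary formula for \<open>gain\<close> once more, the cosine terms at \<open>peak\<close> and \<open>peak - eta\<close>
cancel, as these points are symmetric about \<open>per / 4\<close>.\<close>

lemma gain_has_integral: "(gain has_integral (per * eta / 8)) {per..per + peak}"
proof -
  define Q where "Q u = u\<^sup>2 / 4 + cos (2 * (omega * u)) / (8 * omega\<^sup>2)" for u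
  have Q: "(Q has_real_derivative sin2_area u) (at u)" for u
    unfolding Q_def[abs_def] sin2_area_def using omega_pos
    by (auto intro!: derivative_eq_intros simp: power2_eq_square)
  have gain: "gain x = area (x - per) - area (x - per - eta)" for x
    using gain_periodic[of "x - per"] by (simp add: gain_def)
  have 1: "(gain has_integral (Q eta - Q 0)) {per..per + eta}"
  proof -
    have "((\<lambda>x. sin2_area (x - per)) has_integral ((\<lambda>x. Q (x - per)) (per + eta) - (\<lambda>x. Q (x - per)) per)) {per..per + eta}"
    proof (rule fundamental_theorem_of_calculus)
      fix x
      have "((\<lambda>x. Q (x - per)) has_real_derivative sin2_area (x - per) * 1) (at x)"
        by (rule DERIV_chain2[OF Q]) (auto intro!: derivative_eq_intros)
      then show "((\<lambda>x. Q (x - per)) has_vector_derivative sin2_area (x - per)) (at x within {per..per + eta})"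
        by (simp add: has_real_derivative_iff_has_vector_derivative has_vector_derivative_at_within)
    qed (use eta_bounds in simp)
    moreover have "gain x = sin2_area (x - per)" if "x \<in> {per..per + eta}" for x
      using that eta_bounds per_bounds area_on_hump[of "x - per"] area_before_hump[of "x - per - eta"] by (simp add: gain)
    ultimately show ?thesis using has_integral_cong[of "{per..per + eta}" gain "\<lambda>x. sin2_area (x - per)"] by simp
  qed
  have 2: "(gain has_integral (Q peak - Q (peak - eta) - (Q eta - Q 0))) {per + eta..per + peak}"
  proof -
    have "((\<lambda>x. sin2_area (x - per) - sin2_area (x - per - eta)) has_integral
        ((\<lambda>x. Q (x - per) - Q (x - per - eta)) (per + peak) - (\<lambda>x. Q (x - per) - Q (x - per - eta)) (per + eta)))
        {per + eta..per + peak}"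
    proof (rule fundamental_theorem_of_calculus)
      fix x
      have "((\<lambda>x. Q (x - per) - Q (x - per - eta)) has_real_derivative (sin2_area (x - per) * 1 - sin2_area (x - per - eta) * 1)) (at x)"
        by (intro DERIV_diff DERIV_chain2[OF Q]) (auto intro!: derivative_eq_intros)
      then show "((\<lambda>x. Q (x - per) - Q (x - per - eta)) has_vector_derivative sin2_area (x - per) - sin2_area (x - per - eta))
          (at x within {per + eta..per + peak})"
        by (simp add: has_real_derivative_iff_has_vector_derivative has_vector_derivative_at_within)
    qed (use peak_bounds in simp)
    moreover have "gain x = sin2_area (x - per) - sin2_area (x - per - eta)" if "x \<in> {per + eta..per + peak}" for x
      using that eta_bounds peak_bounds area_on_hump[of "x - per"] area_on_hump[of "x - per - eta"] by (simp add: gain)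
    ultimately show ?thesis
      using has_integral_cong[of "{per + eta..per + peak}" gain "\<lambda>x. sin2_area (x - per) - sin2_area (x - per - eta)"]
      by (simp add: algebra_simps)
  qed
  have "(gain has_integral (Q eta - Q 0 + (Q peak - Q (peak - eta) - (Q eta - Q 0)))) {per..per + peak}"
    by (rule has_integral_combine[OF _ _ 1 2]) (use eta_bounds peak_bounds in auto)
  moreover have "cos (2 * (omega * (peak - eta))) = cos (2 * (omega * peak))"
  proof -
    have "2 * (omega * (peak - eta)) = pi - omega * eta" "2 * (omega * peak) = pi + omega * eta"
      using omega_peak by (simp_all add: algebra_simps)
    then show ?thesis by (simp add: cos_add cos_diff)
  qed
  moreover have "peak\<^sup>2 / 4 - (peak - eta)\<^sup>2 / 4 = per * eta / 8"
    by (simp add: peak_def power2_eq_square field_simps)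
  ultimately show ?thesis by (simp add: Q_def)
qed

text \<open>Convexity of \<open>1 / v\<^sup>3\<close>: the tangent at \<open>c\<close> is \<open>(4 * c - 3 * v) / c\<^sup>4\<close>, and its linear terms cancel in the
sum over a reflected pair.\<close>

lemma weight_reflect_ge:
  assumes "0 < t" "t < 2 * c" shows "2 * weight c \<le> weight t + weight (2 * c - t)"
proof -
  have c: "0 < c" using assms by simp
  have tangent: "(4 * c - 3 * v) / c ^ 4 \<le> 1 / v ^ 3" if "0 < v" for v
  proof -
    have "0 \<le> (c - v)\<^sup>2 * (c\<^sup>2 + 2 * c * v + 3 * v\<^sup>2)" using c that by (intro mult_nonneg_nonneg add_nonneg_nonneg) auto
    also have "\<dots> = c ^ 4 - (4 * c - 3 * v) * v ^ 3"
      by (simp add: eval_nat_numeral algebra_simps)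
    finally show ?thesis using c that by (simp add: field_simps)
  qed
  have "(4 * c - 3 * t) / c ^ 4 + (4 * c - 3 * (2 * c - t)) / c ^ 4 \<le> 1 / t ^ 3 + 1 / (2 * c - t) ^ 3"
    using assms by (intro add_mono tangent) auto
  moreover have "(4 * c - 3 * t) / c ^ 4 + (4 * c - 3 * (2 * c - t)) / c ^ 4 = 2 / c ^ 3"
    using c by (simp add: eval_nat_numeral field_simps)
  ultimately have "2 / pi\<^sup>2 * (2 / c ^ 3) \<le> 2 / pi\<^sup>2 * (1 / t ^ 3 + 1 / (2 * c - t) ^ 3)"
    by (intro mult_left_mono) auto
  then show ?thesis using assms c by (simp add: weight_def distrib_left)
qed

lemma bump_half_integral:
  "(\<integral>\<^sup>+t. ennreal (bump t) * indicator {per..bump_centre} t \<partial>lborel) = ennreal (per * eta / 8 + max_gain * (eta / 2))"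
proof -
  have "((\<lambda>t. bump t) has_integral (per * eta / 8 + max_gain * (eta / 2))) {per..bump_centre}"
  proof (rule has_integral_combine)
    show "(bump has_integral per * eta / 8) {per..per + peak}"
      using gain_has_integral peak_bounds eta_bounds
      by (subst has_integral_cong[of _ _ gain]) (auto simp: bump_def bump_centre_def)
    have "((\<lambda>_. max_gain) has_integral max_gain * (eta / 2)) {per + peak..bump_centre}"
      using has_integral_const_real[of max_gain "per + peak" bump_centre] eta_bounds by (simp add: bump_centre_def mult.commute)
    moreover have "bump t = max_gain" if "t \<in> {per + peak..bump_centre}" for t
      using that peak_bounds eta_bounds gain_periodic[of peak]
      by (auto simp: bump_def bump_centre_def max_gain_def add.commute)
    ultimately show "(bump has_integral max_gain * (eta / 2)) {per + peak..bump_centre}"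
      using has_integral_cong[of "{per + peak..bump_centre}" bump "\<lambda>_. max_gain"] by simp
  qed (use peak_bounds eta_bounds in \<open>auto simp: bump_centre_def\<close>)
  then have "(\<integral>\<^sup>+t. ennreal (indicator {per..bump_centre} t * bump t) \<partial>lborel) = ennreal (per * eta / 8 + max_gain * (eta / 2))"
    by (intro nn_integral_has_integral_lebesgue) (auto simp: bump_nonneg)
  moreover have "(\<integral>\<^sup>+t. ennreal (bump t) * indicator {per..bump_centre} t \<partial>lborel)
      = (\<integral>\<^sup>+t. ennreal (indicator {per..bump_centre} t * bump t) \<partial>lborel)"
    by (intro nn_integral_cong) (auto simp: indicator_def)
  ultimately show ?thesis by simp
qed

text \<open>Folding the integral at the centre of symmetry of \<open>bump\<close> pairs \<open>weight t\<close> with its mirror value, and by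
convexity the pair is at least twice the weight at the centre. What is left is the area under \<open>bump\<close>.\<close>

lemma bump_weighted_ge:
  "ennreal (weight bump_centre * (eta * (per / 4 + max_gain))) \<le> (\<integral>\<^sup>+t. ennreal (weight t * bump t) \<partial>lborel)"
proof -
  have "ennreal (weight bump_centre * (eta * (per / 4 + max_gain))) = ennreal (2 * weight bump_centre) * ennreal (per * eta / 8 + max_gain * (eta / 2))"
    by (subst ennreal_mult[symmetric])
      (use max_gain_pos per_bounds eta_bounds weight_nonneg in \<open>auto simp: algebra_simps\<close>)
  also have "\<dots> = (\<integral>\<^sup>+t. ennreal (2 * weight bump_centre) * (ennreal (bump t) * indicator {per..bump_centre} t) \<partial>lborel)"
    unfolding bump_half_integral[symmetric] by (subst nn_integral_cmult) auto
  also have "\<dots> \<le> (\<integral>\<^sup>+t. ennreal (weight t * bump t) * indicator {..bump_centre} t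
      + ennreal (weight (2 * bump_centre - t) * bump (2 * bump_centre - t)) * indicator {..<bump_centre} t \<partial>lborel)"
  proof (rule nn_integral_mono_AE, rule AE_mp[OF AE_lborel_singleton[of bump_centre]], intro AE_I2 impI)
    fix t assume "t \<noteq> bump_centre"
    show "ennreal (2 * weight bump_centre) * (ennreal (bump t) * indicator {per..bump_centre} t)
      \<le> ennreal (weight t * bump t) * indicator {..bump_centre} t
      + ennreal (weight (2 * bump_centre - t) * bump (2 * bump_centre - t)) * indicator {..<bump_centre} t"
    proof (cases "per \<le> t \<and> t \<le> bump_centre")
      case True
      have "2 * weight bump_centre * bump t \<le> (weight t + weight (2 * bump_centre - t)) * bump t"
        using True per_bounds \<open>t \<noteq> bump_centre\<close> bump_nonneg
        by (intro mult_right_mono weight_reflect_ge) auto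
      then show ?thesis using True \<open>t \<noteq> bump_centre\<close>
        by (simp add: bump_reflect bump_nonneg weight_nonneg distrib_right
            flip: ennreal_mult ennreal_plus)
    qed auto
  qed
  also have "\<dots> = (\<integral>\<^sup>+t. ennreal (weight t * bump t) * indicator {..bump_centre} t \<partial>lborel)
      + (\<integral>\<^sup>+t. ennreal (weight (2 * bump_centre - t) * bump (2 * bump_centre - t)) * indicator {..<bump_centre} t \<partial>lborel)"
    by (rule nn_integral_add) measurable
  also have "(\<integral>\<^sup>+t. ennreal (weight (2 * bump_centre - t) * bump (2 * bump_centre - t)) * indicator {..<bump_centre} t \<partial>lborel)
      = (\<integral>\<^sup>+t. ennreal (weight t * bump t) * indicator {bump_centre<..} t \<partial>lborel)"
    by (subst (2) nn_integral_reflect[of _ "2 * bump_centre"])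
      (auto intro!: nn_integral_cong simp: indicator_def)
  also have "(\<integral>\<^sup>+t. ennreal (weight t * bump t) * indicator {..bump_centre} t \<partial>lborel) + \<dots>
      = (\<integral>\<^sup>+t. ennreal (weight t * bump t) * indicator {..bump_centre} t + ennreal (weight t * bump t) * indicator {bump_centre<..} t \<partial>lborel)"
    by (rule nn_integral_add[symmetric]) measurable
  also have "\<dots> = (\<integral>\<^sup>+t. ennreal (weight t * bump t) \<partial>lborel)"
    by (intro nn_integral_cong) (auto simp: indicator_def)
  finally show ?thesis .
qed

text \<open>The factor \<open>1 / (pi\<^sup>2 * (1/2)\<^sup>2)\<close> in \<open>Y\<close> is the total weight of all \<open>t \<ge> 1/2\<close>, on which the advantage
\<open>early_gain\<close> of the premature jump counts.\<close>

lemma E_fun_early_jump: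
  assumes "admissible \<tau>" "\<tau> 1 \<le> per"
  shows "E_fun p \<tau> < E_fun p opt_seq"
proof -
  define X where "X = weight bump_centre * (eta * (per / 4 + max_gain))"
  define Y where "Y = early_gain * (1 / (pi\<^sup>2 * (1/2)\<^sup>2))"
  have kap0: "0 \<le> early_gain" by (simp add: early_gain_def gain_nonneg)
  have ctr0: "0 < bump_centre" using eta_bounds by (simp add: bump_centre_eq)
  have "Y < X"
  proof -
    have "4 * early_gain < 2 * (eta * (per / 4 + max_gain)) / bump_centre ^ 3"
      using early_gain_small ctr0 by (simp add: field_simps)
    from divide_strict_right_mono[OF this, of "pi\<^sup>2"] show ?thesis
      using ctr0 by (simp add: X_def Y_def weight_def power2_eq_square field_simps)
  qed
  have "0 \<le> Y" using kap0 by (simp add: Y_def)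
  then have XY: "0 \<le> Y" "0 \<le> X" using \<open>Y < X\<close> by auto
  have "E_fun p \<tau> + ennreal X \<le> (\<integral>\<^sup>+t. ennreal (weight t * cumulative \<tau> t) \<partial>lborel) + (\<integral>\<^sup>+t. ennreal (weight t * bump t) \<partial>lborel)"
    unfolding E_fun_layers[OF assms(1)] X_def by (intro add_left_mono bump_weighted_ge)
  also have "\<dots> = (\<integral>\<^sup>+t. ennreal (weight t * cumulative \<tau> t) + ennreal (weight t * bump t) \<partial>lborel)"
    by (rule nn_integral_add[symmetric]) measurable
  also have "\<dots> \<le> (\<integral>\<^sup>+t. ennreal (weight t * cumulative opt_seq t) + ennreal early_gain * (ennreal (weight t) * indicator {1/2..} t) \<partial>lborel)"
  proof (intro nn_integral_mono)
    fix t :: real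
    show "ennreal (weight t * cumulative \<tau> t) + ennreal (weight t * bump t)
      \<le> ennreal (weight t * cumulative opt_seq t) + ennreal early_gain * (ennreal (weight t) * indicator {1/2..} t)"
    proof (cases "0 < t")
      case True
      define i :: real where "i = (if 1/2 \<le> t then early_gain else 0)"
      have i: "0 \<le> i" using kap0 by (simp add: i_def)
      have "weight t * (cumulative \<tau> t + bump t) \<le> weight t * (cumulative opt_seq t + i)"
        unfolding i_def using True by (intro mult_left_mono weight_nonneg cumulative_early_jump[OF assms]) auto
      then have "ennreal (weight t * cumulative \<tau> t) + ennreal (weight t * bump t) \<le> ennreal (weight t * cumulative opt_seq t) + ennreal (weight t * i)"
        using i cumulative_nonneg bump_nonneg weight_nonneg
        by (simp add: distrib_left flip: ennreal_plus)
      also have "ennreal (weight t * i) = ennreal early_gain * (ennreal (weight t) * indicator {1/2..} t)"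
        using kap0 weight_nonneg by (simp add: i_def mult.commute flip: ennreal_mult)
      finally show ?thesis .
    qed (simp add: weight_def)
  qed
  also have "\<dots> = E_fun p opt_seq + ennreal early_gain * (\<integral>\<^sup>+t. ennreal (weight t) * indicator {1/2..} t \<partial>lborel)"
    unfolding E_fun_layers[OF admissible_opt_seq]
    by (subst nn_integral_add) (auto simp: nn_integral_cmult)
  also have "\<dots> = E_fun p opt_seq + ennreal Y"
    using kap0 nn_integral_weight_tail[of "1/2"] by (simp add: Y_def flip: ennreal_mult)
  finally have le: "E_fun p \<tau> + ennreal X \<le> E_fun p opt_seq + ennreal Y" .
  obtain a where a: "E_fun p \<tau> = ennreal a" "0 \<le> a" using E_fun_finite[OF assms(1)] by (cases "E_fun p \<tau>") auto
  obtain b where b: "E_fun p opt_seq = ennreal b" "0 \<le> b" using E_fun_finite[OF admissible_opt_seq] by (cases "E_fun p opt_seq") auto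
  have "a + X \<le> b + Y" using le a b XY by (simp flip: ennreal_plus)
  then show ?thesis using a b \<open>Y < X\<close> by (simp add: ennreal_less_iff)
qed

section \<open>The value at the optimal sequence\<close>

lemma E_fun_less_opt_seq:
  assumes "admissible \<tau>" "\<tau> \<noteq> opt_seq"
  shows "E_fun p \<tau> < E_fun p opt_seq"
proof (cases "\<tau> 1 \<le> per")
  case True
  then show ?thesis by (rule E_fun_early_jump[OF assms(1)])
next
  case False
  then have late: "per < \<tau> 1" by simp
  obtain a b where ab: "0 < a" "a < b" "\<And>t. a < t \<Longrightarrow> t < b \<Longrightarrow> cumulative \<tau> t < cumulative opt_seq t"
    by (rule cumulative_less_opt_seq[OF assms(1) late assms(2)]) blast
  show ?thesis
    unfolding E_fun_layers[OF assms(1)] E_fun_layers[OF admissible_opt_seq]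
  proof (rule nn_integral_less)
    show "(\<integral>\<^sup>+t. ennreal (weight t * cumulative \<tau> t) \<partial>lborel) \<noteq> \<infinity>"
      using E_fun_finite[OF assms(1)] by (simp add: E_fun_layers[OF assms(1)])
    show "AE t in lborel. ennreal (weight t * cumulative \<tau> t) \<le> ennreal (weight t * cumulative opt_seq t)"
    proof (intro AE_I2 ennreal_leI)
      fix t
      show "weight t * cumulative \<tau> t \<le> weight t * cumulative opt_seq t"
      proof (cases "0 < t")
        case True
        then show ?thesis using cumulative_le_opt_seq[OF assms(1) late, of t] by (intro mult_left_mono weight_nonneg) simp
      qed (simp add: weight_def)
    qed
    show "\<not> (AE t in lborel. ennreal (weight t * cumulative opt_seq t) \<le> ennreal (weight t * cumulative \<tau> t))"
    proof
      assume "AE t in lborel. ennreal (weight t * cumulative opt_seq t) \<le> ennreal (weight t * cumulative \<tau> t)"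
      then obtain t where t: "a < t" "t < b" "ennreal (weight t * cumulative opt_seq t) \<le> ennreal (weight t * cumulative \<tau> t)"
        using AE_lborel_interval_witness[OF _ ab(2)] by blast
      have "0 < weight t" using t ab by (simp add: weight_def)
      moreover have "weight t * cumulative opt_seq t \<le> weight t * cumulative \<tau> t"
        using t(3) cumulative_nonneg weight_nonneg by (simp add: ennreal_le_iff)
      ultimately show False using ab(3)[OF t(1,2)] by simp
    qed
  qed measurable
qed

definition phase_density :: "nat \<Rightarrow> real \<Rightarrow> real" where
  "phase_density n x = (sin (p / 2 * pi * (x - real n)))\<^sup>2 / (pi\<^sup>2 * x\<^sup>2)"

lemma phase_density_measurable [measurable]: "phase_density n \<in> borel_measurable borel"
  unfolding phase_density_def[abs_def] by measurable

lemma phase_density_nonneg: "0 \<le> phase_density n x" by (simp add: phase_density_def)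

lemma opt_seq_position: "opt_seq n \<le> real n + per / 2" "real n \<le> opt_seq n" "n = 0 \<or> opt_seq n = real n - 1/2 + 3/4 * per"
  "opt_seq (Suc n) = real n + 1/2 + 3/4 * per"
proof -
  have "3 / p = 3/4 * per" by (simp add: per_def)
  then show "opt_seq n \<le> real n + per / 2" "real n \<le> opt_seq n" "n = 0 \<or> opt_seq n = real n - 1/2 + 3/4 * per"
    "opt_seq (Suc n) = real n + 1/2 + 3/4 * per"
    using per_bounds by (auto simp: opt_seq_def)
qed

text \<open>Between consecutive jumps of the optimal sequence the sine is positive at the beginning and at the
end, with one complete negative half wave in between.\<close>

lemma cell_density:
  assumes x: "opt_seq n < x" "x < opt_seq (Suc n)" "x \<noteq> real n + per / 2" "x \<noteq> real n + per"
  shows "ennreal ((max 0 (K_fun p opt_seq x))\<^sup>2)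
    = ennreal (phase_density n x) * indicator {opt_seq n..real n + per / 2} x
    + ennreal (phase_density n x) * indicator {real n + per..opt_seq (Suc n)} x"
proof -
  have o: "strict_mono opt_seq" "opt_seq 0 = 0" using admissibleD(1,2)[OF admissible_opt_seq] .
  have x0: "0 < x" using x opt_seq_position(2)[of n] by simp
  have "integrand opt_seq x = hump (x - real n)"
    using integrand_cell[OF o x(1,2)] hump_periodic_nat[of "x - real n" n] by (simp add: eta_def algebra_simps)
  then have K: "(max 0 (K_fun p opt_seq x))\<^sup>2 = hump (x - real n) / (pi\<^sup>2 * x\<^sup>2)"
    using x0 by (simp add: integrand_def power_mult_distrib field_simps)
  consider "x < real n + per / 2" | "real n + per / 2 < x" "x < real n + per" | "real n + per < x"
    using x by linarith
  then show ?thesis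
  proof cases
    case 1
    then have "hump (x - real n) = (sin (omega * (x - real n)))\<^sup>2"
      using x opt_seq_position(2)[of n] by (intro hump_on_hump) auto
    then show ?thesis using 1 x per_bounds by (simp add: K phase_density_def omega_def)
  next
    case 2
    then have "hump (x - real n) = 0" by (intro hump_off_hump) auto
    then show ?thesis using 2 by (simp add: K)
  next
    case 3
    have "hump (x - real n) = hump (x - real n - per)" using hump_periodic[of "x - real n - per"] by simp
    also have "\<dots> = (sin (omega * (x - real n - per)))\<^sup>2"
      using x 3 per_bounds opt_seq_position(4)[of n] by (intro hump_on_hump) auto
    also have "omega * (x - real n - per) = omega * (x - real n) - 2 * pi" using omega_per by (simp add: algebra_simps)
    also have "sin (omega * (x - real n) - 2 * pi) = sin (omega * (x - real n))" by (simp add: sin_diff)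
    finally show ?thesis using 3 x per_bounds by (simp add: K phase_density_def omega_def)
  qed
qed

lemma cell_split:
  "(\<integral>\<^sup>+x. ennreal ((max 0 (K_fun p opt_seq x))\<^sup>2) * indicator {opt_seq n..<opt_seq (Suc n)} x \<partial>lborel)
    = (\<integral>\<^sup>+x. ennreal (phase_density n x) * indicator {opt_seq n..real n + per / 2} x \<partial>lborel)
    + (\<integral>\<^sup>+x. ennreal (phase_density n x) * indicator {real n + per..opt_seq (Suc n)} x \<partial>lborel)"
proof -
  have "(\<integral>\<^sup>+x. ennreal ((max 0 (K_fun p opt_seq x))\<^sup>2) * indicator {opt_seq n..<opt_seq (Suc n)} x \<partial>lborel)
    = (\<integral>\<^sup>+x. ennreal (phase_density n x) * indicator {opt_seq n..real n + per / 2} x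
      + ennreal (phase_density n x) * indicator {real n + per..opt_seq (Suc n)} x \<partial>lborel)"
  proof (rule nn_integral_cong_AE)
    have "AE x in lborel. x \<notin> {opt_seq n, opt_seq (Suc n), real n + per / 2, real n + per}"
      by (intro AE_not_in finite_imp_null_set_lborel) simp
    then show "AE x in lborel. ennreal ((max 0 (K_fun p opt_seq x))\<^sup>2) * indicator {opt_seq n..<opt_seq (Suc n)} x
      = ennreal (phase_density n x) * indicator {opt_seq n..real n + per / 2} x
      + ennreal (phase_density n x) * indicator {real n + per..opt_seq (Suc n)} x"
    proof eventually_elim
      case (elim x)
      have next_cell: "opt_seq n < real n + per" "real n + per / 2 < opt_seq (Suc n)"
        using opt_seq_position(1,4)[of n] per_bounds by linarith+
      show ?case
      proof (cases "opt_seq n < x \<and> x < opt_seq (Suc n)")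
        case True
        then show ?thesis using cell_density[of n x] elim by simp
      next
        case False
        then consider "x < opt_seq n" | "opt_seq (Suc n) < x" using elim by fastforce
        then show ?thesis
          by cases (use opt_seq_position(1,2,4)[of n] opt_seq_position(1)[of "Suc n"] per_bounds next_cell in simp_all)
      qed
    qed
  qed
  also have "\<dots> = (\<integral>\<^sup>+x. ennreal (phase_density n x) * indicator {opt_seq n..real n + per / 2} x \<partial>lborel)
    + (\<integral>\<^sup>+x. ennreal (phase_density n x) * indicator {real n + per..opt_seq (Suc n)} x \<partial>lborel)"
    by (rule nn_integral_add) measurable
  finally show ?thesis .
qed

lemma E_fun_cells:
  "E_fun p opt_seq = (\<Sum>n. \<integral>\<^sup>+x. ennreal ((max 0 (K_fun p opt_seq x))\<^sup>2) * indicator {opt_seq n..<opt_seq (Suc n)} x \<partial>lborel)"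
proof -
  have [measurable]: "K_fun p opt_seq \<in> borel_measurable borel"
    unfolding K_fun_def[abs_def] by measurable
  have "E_fun p opt_seq = (\<integral>\<^sup>+x. (\<Sum>n. ennreal ((max 0 (K_fun p opt_seq x))\<^sup>2) * indicator {opt_seq n..<opt_seq (Suc n)} x) \<partial>lborel)"
    unfolding E_fun_def
  proof (intro nn_integral_cong)
    fix x :: real
    have "(\<Sum>n. indicator {opt_seq n..<opt_seq (Suc n)} x) = (indicator (\<Union>n. {opt_seq n..<opt_seq (Suc n)}) x :: ennreal)"
    proof (rule suminf_indicator)
      have "disjoint_family (\<lambda>n. {..<opt_seq (Suc n)} - {..<opt_seq n})"
        using strict_mono_less_eq[OF admissibleD(1)[OF admissible_opt_seq]] by (intro disjoint_family_Suc) auto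
      moreover have "{..<opt_seq (Suc n)} - {..<opt_seq n} = {opt_seq n..<opt_seq (Suc n)}" for n by auto
      ultimately show "disjoint_family (\<lambda>n. {opt_seq n..<opt_seq (Suc n)})" by simp
    qed
    moreover have "(\<Union>n. {opt_seq n..<opt_seq (Suc n)}) = {0..}"
    proof (intro equalityI subsetI)
      show "v \<in> {0..}" if v: "v \<in> (\<Union>n. {opt_seq n..<opt_seq (Suc n)})" for v
      proof -
        obtain n where "opt_seq n \<le> v" using v by auto
        then show ?thesis using opt_seq_position(2)[of n] by simp
      qed
      show "v \<in> (\<Union>n. {opt_seq n..<opt_seq (Suc n)})" if v: "v \<in> {0..}" for v
      proof -
        obtain n where "opt_seq n \<le> v" "v < opt_seq (Suc n)" using admissible_cell[OF admissible_opt_seq, of v] v by auto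
        then show ?thesis by auto
      qed
    qed
    ultimately show "ennreal ((max 0 (K_fun p opt_seq x))\<^sup>2) * indicator {0..} x
      = (\<Sum>n. ennreal ((max 0 (K_fun p opt_seq x))\<^sup>2) * indicator {opt_seq n..<opt_seq (Suc n)} x)"
      by simp
  qed
  also have "\<dots> = (\<Sum>n. \<integral>\<^sup>+x. ennreal ((max 0 (K_fun p opt_seq x))\<^sup>2) * indicator {opt_seq n..<opt_seq (Suc n)} x \<partial>lborel)"
    by (rule nn_integral_suminf) measurable
  finally show ?thesis .
qed

text \<open>The beginning of cell \<open>0\<close> gives the first integral, the beginnings of the cells \<open>n + 1\<close> give the second
series, and the ends of all cells give the first series.\<close>

lemma E_fun_opt_seq_eq:
  "E_fun p opt_seq = ennreal (
        (LBINT x=0..2/p. (sin (p/2 * pi * x))\<^sup>2 / (pi\<^sup>2 * x\<^sup>2))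
      + (\<Sum>n. LBINT x=real n + 4/p..real n + 1/2 + 3/p.
            (sin (p/2 * pi * (x - real n)))\<^sup>2 / (pi\<^sup>2 * x\<^sup>2))
      + (\<Sum>n. LBINT x=real n + 1/2 + 3/p..real n + 1 + 2/p.
            (sin (p/2 * pi * (x - real n - 1)))\<^sup>2 / (pi\<^sup>2 * x\<^sup>2)))"
proof -
  define I where "I = (\<lambda>n a b. \<integral>\<^sup>+x. ennreal (phase_density n x) * indicator {a..b} x \<partial>lborel)"
  define f where "f n = (LBINT x = (opt_seq n)..real n + per / 2. phase_density n x)" for n
  define g where "g n = (LBINT x=real n + per..opt_seq (Suc n). phase_density n x)" for n
  have E: "E_fun p opt_seq = (\<Sum>n. I n (opt_seq n) (real n + per / 2)) + (\<Sum>n. I n (real n + per) (opt_seq (Suc n)))"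
    unfolding E_fun_cells cell_split I_def by (rule suminf_add[symmetric]) (auto intro: summableI)
  have term_le: "h n \<le> (\<Sum>n. h n)" for h :: "nat \<Rightarrow> ennreal" and n
    using sum_le_suminf[of h "{n}"] by (auto intro: summableI)
  have fin: "(\<Sum>n. I n (opt_seq n) (real n + per / 2)) < \<infinity>" "(\<Sum>n. I n (real n + per) (opt_seq (Suc n))) < \<infinity>"
    using E_fun_finite[OF admissible_opt_seq] unfolding E by auto
  have If: "I n (opt_seq n) (real n + per / 2) = ennreal (f n)" for n
    unfolding I_def f_def
  proof (rule nn_integral_Icc_eq_LBINT)
    show "(\<integral>\<^sup>+x. ennreal (phase_density n x) * indicator {opt_seq n..real n + per / 2} x \<partial>lborel) < \<infinity>"
      using order.strict_trans1[OF term_le fin(1), of n] by (simp only: I_def)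
  qed (simp_all add: phase_density_nonneg opt_seq_position(1))
  have Ig: "I n (real n + per) (opt_seq (Suc n)) = ennreal (g n)" for n
    unfolding I_def g_def
  proof (rule nn_integral_Icc_eq_LBINT)
    show "(\<integral>\<^sup>+x. ennreal (phase_density n x) * indicator {real n + per..opt_seq (Suc n)} x \<partial>lborel) < \<infinity>"
      using order.strict_trans1[OF term_le fin(2), of n] by (simp only: I_def)
    show "real n + per \<le> opt_seq (Suc n)" using opt_seq_position(4)[of n] per_bounds by simp
  qed (simp_all add: phase_density_nonneg)
  have f0: "0 \<le> f n" for n
    unfolding f_def by (rule LBINT_nonneg[OF opt_seq_position(1) phase_density_nonneg])
  have g0: "0 \<le> g n" for n
  proof -
    have "real n + per \<le> opt_seq (Suc n)" using opt_seq_position(4)[of n] per_bounds by simp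
    then show ?thesis unfolding g_def by (rule LBINT_nonneg) (rule phase_density_nonneg)
  qed
  have sf: "summable f" "(\<Sum>n. ennreal (f n)) = ennreal (\<Sum>n. f n)"
    using fin(1) f0 unfolding If by (simp_all add: summable_suminf_not_top)
  have sg: "summable g" "(\<Sum>n. ennreal (g n)) = ennreal (\<Sum>n. g n)"
    using fin(2) g0 unfolding Ig by (simp_all add: summable_suminf_not_top)
  have "E_fun p opt_seq = ennreal ((\<Sum>n. f n) + (\<Sum>n. g n))"
    unfolding E If Ig sf sg using f0 g0 sf sg by (simp add: suminf_nonneg)
  also have "(\<Sum>n. f n) = f 0 + (\<Sum>n. f (Suc n))" using suminf_split_head[OF sf(1)] by simp
  also have "f 0 = (LBINT x=0..2/p. (sin (p/2 * pi * x))\<^sup>2 / (pi\<^sup>2 * x\<^sup>2))"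
    by (simp add: f_def opt_seq_def per_def phase_density_def zero_ereal_def)
  also have "(\<lambda>n. f (Suc n)) = (\<lambda>n. LBINT x=real n + 1/2 + 3/p..real n + 1 + 2/p.
            (sin (p/2 * pi * (x - real n - 1)))\<^sup>2 / (pi\<^sup>2 * x\<^sup>2))"
  proof -
    have "opt_seq (Suc n) = real n + 1/2 + 3/p" "real (Suc n) + per / 2 = real n + 1 + 2/p"
      "x - real (Suc n) = x - real n - 1" for n x
      by (simp_all add: opt_seq_def per_def)
    then show ?thesis unfolding f_def phase_density_def by (simp only:)
  qed
  also have "g = (\<lambda>n. LBINT x=real n + 4/p..real n + 1/2 + 3/p.
            (sin (p/2 * pi * (x - real n)))\<^sup>2 / (pi\<^sup>2 * x\<^sup>2))"
  proof -
    have "opt_seq (Suc n) = real n + 1/2 + 3/p" for n by (simp add: opt_seq_def)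
    then show ?thesis unfolding g_def[abs_def] phase_density_def per_def by (simp only:)
  qed
  finally show ?thesis by (simp add: add_ac)
qed

end

section \<open>The supremum and its unique maximiser\<close>

theorem theorem1p3:
  fixes p \<delta>\<^sub>1 \<delta>\<^sub>2 :: real
  assumes "4 < p" and "p \<le> 5"
    and "1/2 \<le> \<delta>\<^sub>1" and "\<delta>\<^sub>1 \<le> 1/2 + 3/p"
    and "1 - 2/p \<le> \<delta>\<^sub>2" and "\<delta>\<^sub>2 \<le> 1"
  shows "E_sup p \<delta>\<^sub>1 \<delta>\<^sub>2 = ennreal (
        (LBINT x=0..2/p. (sin (p/2 * pi * x))\<^sup>2 / (pi\<^sup>2 * x\<^sup>2))
      + (\<Sum>n. LBINT x=real n + 4/p..real n + 1/2 + 3/p.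
            (sin (p/2 * pi * (x - real n)))\<^sup>2 / (pi\<^sup>2 * x\<^sup>2))
      + (\<Sum>n. LBINT x=real n + 1/2 + 3/p..real n + 1 + 2/p.
            (sin (p/2 * pi * (x - real n - 1)))\<^sup>2 / (pi\<^sup>2 * x\<^sup>2)))
    \<and> (\<forall>\<tau>. (\<tau> \<in> T_seqs \<delta>\<^sub>1 \<delta>\<^sub>2 \<and> E_fun p \<tau> = E_sup p \<delta>\<^sub>1 \<delta>\<^sub>2) \<longleftrightarrow>
           (\<tau> 0 = 0 \<and> (\<forall>n\<ge>1. \<tau> n = real n - 1/2 + 3/p)))"
proof -
  interpret sine_blocks p using assms(1,2) by unfold_locales
  have admissible: "admissible \<tau>" if "\<tau> \<in> T_seqs \<delta>\<^sub>1 \<delta>\<^sub>2" for \<tau>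
  proof -
    have "1 - per / 2 \<le> \<delta>\<^sub>2" using assms(5) by (simp add: per_def)
    then show ?thesis using that assms(3) unfolding admissible_def T_seqs_def by (auto intro: order_trans)
  qed
  have opt_seq: "opt_seq \<in> T_seqs \<delta>\<^sub>1 \<delta>\<^sub>2" by (rule opt_seq_in_T_seqs[OF assms(4,6)])
  have sup: "E_sup p \<delta>\<^sub>1 \<delta>\<^sub>2 = E_fun p opt_seq"
    unfolding E_sup_def
  proof (rule antisym)
    show "(SUP \<tau>\<in>T_seqs \<delta>\<^sub>1 \<delta>\<^sub>2. E_fun p \<tau>) \<le> E_fun p opt_seq"
    proof (rule SUP_least)
      fix \<tau> assume "\<tau> \<in> T_seqs \<delta>\<^sub>1 \<delta>\<^sub>2"
      then show "E_fun p \<tau> \<le> E_fun p opt_seq"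
        using E_fun_less_opt_seq[OF admissible] by (cases "\<tau> = opt_seq") (auto intro: less_imp_le)
    qed
  qed (rule SUP_upper[OF opt_seq])
  have "\<tau> = opt_seq \<longleftrightarrow> \<tau> 0 = 0 \<and> (\<forall>n\<ge>1. \<tau> n = real n - 1/2 + 3/p)" for \<tau>
    by (auto simp: opt_seq_def fun_eq_iff Suc_le_eq)
  moreover have "\<tau> \<in> T_seqs \<delta>\<^sub>1 \<delta>\<^sub>2 \<and> E_fun p \<tau> = E_sup p \<delta>\<^sub>1 \<delta>\<^sub>2 \<longleftrightarrow> \<tau> = opt_seq" for \<tau>
  proof
    assume "\<tau> \<in> T_seqs \<delta>\<^sub>1 \<delta>\<^sub>2 \<and> E_fun p \<tau> = E_sup p \<delta>\<^sub>1 \<delta>\<^sub>2"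
    then show "\<tau> = opt_seq" using E_fun_less_opt_seq[OF admissible, of \<tau>] sup by fastforce
  qed (use opt_seq sup in simp)
  ultimately show ?thesis using sup E_fun_opt_seq_eq by simp
qed

end
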